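(* Fix $\beta,n\in\mathbb{N}$. For every $s\in\mathbb{C}$ with $\operatorname{Re}(s)=1$, the series $\sum_{q=1}^\infty c_q^{(\beta)}(n)q^{-s}$ converges and $$\sum_{q=1}^\infty\frac{c_q^{(\beta)}(n)}{q^s}=\frac{\sigma^{(\beta)}_{1-s/\beta}(n)}{\zeta(s)},$$ where at $s=1$ the right-hand side is interpreted as $0$ (since $\zeta$ has a pole there).
   Context: For $\beta,q,n\in\mathbb{N}$, $c_q^{(\beta)}(n)=\sum e^{2\pi i nh/q^\beta}$, the sum over integers $0\le h<q^\beta$ such that $h$ and $q^\beta$ have no common divisor of the form $d^\beta$ with $d>1$. For $z\in\mathbb{C}$, $\sigma_z^{(\beta)}(n)=\sum_{d\in\mathbb{N},\ d^\beta\mid n}d^{\beta z}$. *)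

theory Defs
  imports "HOL-Analysis.Analysis"
begin

definition ramanujan_sum_gen :: "nat \<Rightarrow> nat \<Rightarrow> nat \<Rightarrow> complex" where
  "ramanujan_sum_gen \<beta> q n =
     (\<Sum>h \<in> {h. h < q ^ \<beta> \<and> \<not> (\<exists>d::nat. d > 1 \<and> d ^ \<beta> dvd h \<and> d ^ \<beta> dvd q ^ \<beta>)}.
        exp (2 * of_real pi * \<i> * of_nat n * of_nat h / of_nat (q ^ \<beta>)))"

definition sigma_gen :: "nat \<Rightarrow> complex \<Rightarrow> nat \<Rightarrow> complex" where
  "sigma_gen \<beta> z n = (\<Sum>d \<in> {d::nat. d > 0 \<and> d ^ \<beta> dvd n}. (of_nat (d ^ \<beta>) :: complex) powr z)"

text \<open>Riemann zeta function on Re s > 0, s \<noteq> 1 (analytic continuation), via the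
  classical formula zeta(s) = lim_N (sum_{k=1}^N k^{-s} - N^{1-s}/(1-s)).\<close>
definition zeta :: "complex \<Rightarrow> complex" where
  "zeta s = lim (\<lambda>N::nat. (\<Sum>k=1..N. (of_nat k :: complex) powr (-s)) - (of_nat N :: complex) powr (1 - s) / (1 - s))"

end

(* Sorting the residues h by their common divisors with q gives
   c_q(n) = sum over d | q with d^beta | n of d^beta mu(q/d), so the series is a finite combination,
   over the d with d^beta | n, of copies of sum mu(m) m^(-s). Everything thus rests on the
   convergence of sum mu(m) m^(-s) to 1 / zeta(s) on the line Re s = 1, which follows from Newman's
   analytic theorem once 1 / zeta is known to be holomorphic near Re s >= 1. The function
   (s - 1) zeta(s) is continued to Re s > 0 by partial summation, and its non-vanishing on
   Re s = 1 comes from 3 + 4 cos t + cos 2t >= 0 applied to -zeta'/zeta = sum Lambda(m) m^(-s). *)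
theory Submission
  imports Defs "HOL-Complex_Analysis.Complex_Analysis" "HOL-Number_Theory.Number_Theory"
    "HOL-Computational_Algebra.Squarefree"
begin

text \<open>On Re s = 1 the series of mu(m) m^(-s) does not converge absolutely, so products of
  Dirichlet series are available only for Re s > 1, and the line itself has to be reached
  analytically. Newman's argument needs no growth bound for 1 / zeta: it asks only for coefficients
  of norm at most 1/k and for holomorphy on some open set around the closed half plane. The first
  demand is met by moving a point w of the line to 0, since mu(k) k^(-w) has norm at most 1/k when
  Re w = 1. The pole of zeta is removed from the start by working with \<open>zeta_reg\<close>, that
  is (s - 1) zeta(s), whose value at 1 is 1. The sum over m is then (s - 1) /
  \<open>zeta_reg s\<close> on the whole line, and s = 1 is an ordinary point where this is 0; that
  instance is the classical sum of mu(m)/m being 0.\<close>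

section \<open>Sums of real powers compared with integrals\<close>

lemma norm_of_nat_powr: "n > 0 \<Longrightarrow> norm ((of_nat n :: complex) powr z) = real n powr Re z"
  by (subst norm_powr_real_powr) auto

lemma powr_diff_mvt:
  fixes a u v :: real
  assumes "0 < u" "u < v"
  obtains w where "u < w" "w < v" "v powr a - u powr a = (v - u) * (a * w powr (a - 1))"
proof -
  have "\<exists>w>u. w < v \<and> v powr a - u powr a = (v - u) * (a * w powr (a - 1))"
    using assms by (intro MVT2) (auto intro!: derivative_eq_intros)
  then show ?thesis using that by blast
qed

text \<open>By the mean value theorem the difference of the two powers is x w^(-1-x) for some w < n
  + 1. The right-hand side telescopes, which gives the tail estimate that follows.\<close>

lemma powr_neg_step:
  fixes x :: real
  assumes "x > 0" "n \<ge> (1::nat)"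
  shows "real (Suc n) powr (-1 - x) \<le> (real n powr (-x) - real (Suc n) powr (-x)) / x"
proof -
  obtain w where w: "real n < w" "w < real (Suc n)"
    "real (Suc n) powr (-x) - real n powr (-x) = (real (Suc n) - real n) * (-x * w powr (-x - 1))"
    using powr_diff_mvt[of "real n" "real (Suc n)" "-x"] assms by auto
  have "real (Suc n) powr (-1 - x) \<le> w powr (-1 - x)"
    using w assms by (intro powr_mono2') auto
  also have "-x - 1 = -1 - x" by simp
  with w(3) have "w powr (-1 - x) = (real n powr (-x) - real (Suc n) powr (-x)) / x"
    using assms by (simp add: field_simps)
  finally show ?thesis .
qed

lemma sum_powr_tail:
  fixes x :: real
  assumes "x > 0" "n \<ge> (1::nat)"
  shows "(\<Sum>k<m. real (Suc (n + k)) powr (-1 - x)) \<le> (real n powr (-x) - real (n + m) powr (-x)) / x"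
proof (induction m)
  case (Suc m)
  show ?case using powr_neg_step[of x "n + m"] assms Suc by (simp add: diff_divide_distrib)
qed auto

text \<open>The sign of x - 1 decides the direction of the comparison. An increasing summand is
  bounded by the increment of t^x / x to its right, which leaves the term k = n over and accounts
  for the first summand of the bound; a decreasing one is bounded by the increment to its
  left.\<close>

lemma sum_powr_head:
  fixes x :: real
  assumes "x > 0" "n \<ge> (1::nat)"
  shows "(\<Sum>k=1..n. real k powr (x - 1)) \<le> real n powr (x - 1) + real n powr x / x"
proof (cases "x \<ge> 1")
  case True
  show ?thesis using assms(2)
  proof (induction n rule: dec_induct)
    case (step n)
    obtain w where w: "real n < w" "w < real (Suc n)"
      "real (Suc n) powr x - real n powr x = (real (Suc n) - real n) * (x * w powr (x - 1))"
      using powr_diff_mvt[of "real n" "real (Suc n)" x] step by auto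
    have "real n powr (x - 1) \<le> w powr (x - 1)"
      using w True by (intro powr_mono2) auto
    also have "\<dots> = (real (Suc n) powr x - real n powr x) / x"
      using w(3) assms by (simp add: field_simps)
    finally show ?case using step by (simp add: diff_divide_distrib)
  qed (use assms in simp)
next
  case False
  have "(\<Sum>k=1..n. real k powr (x - 1)) \<le> real n powr x / x" using assms(2)
  proof (induction n rule: dec_induct)
    case base
    then show ?case using False assms by (simp add: field_simps)
  next
    case (step n)
    obtain w where w: "real n < w" "w < real (Suc n)"
      "real (Suc n) powr x - real n powr x = (real (Suc n) - real n) * (x * w powr (x - 1))"
      using powr_diff_mvt[of "real n" "real (Suc n)" x] step by auto
    have "real (Suc n) powr (x - 1) \<le> w powr (x - 1)"
      using w False by (intro powr_mono2') auto
    also have "\<dots> = (real (Suc n) powr x - real n powr x) / x"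
      using w(3) assms by (simp add: field_simps)
    finally show ?case using step by (simp add: diff_divide_distrib)
  qed
  then show ?thesis using powr_ge_zero[of "real n" "x - 1"] by linarith
qed

section \<open>Half contours around the origin\<close>

lemma has_contour_integral_inverse_arc:
  assumes "R > 0" "a < b"
  shows "((\<lambda>z. 1 / z) has_contour_integral (\<i> * of_real (b - a))) (part_circlepath 0 R a b)"
proof -
  have "((\<lambda>t::real. \<i>) has_integral (b - a) *\<^sub>R \<i>) {a..b}"
    using has_integral_const_real[of \<i> a b] assms by simp
  moreover have "1 / (0 + complex_of_real R * cis t) * of_real R * \<i> * cis t = \<i>" for t
    using assms by (simp add: field_simps)
  ultimately show ?thesis
    using assms by (simp add: has_contour_integral_part_circlepath_iff scaleR_conv_of_real mult.commute)
qed

text \<open>A left half contour for a function known to be holomorphic only slightly to the left of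
  the imaginary axis: it leads from iR to -iR past 0 at distance d, and closes up with the right
  half circle.\<close>

definition notch :: "real \<Rightarrow> real \<Rightarrow> real \<Rightarrow> complex" where
  "notch R d = linepath (Complex 0 R) (Complex (-d) R) +++ linepath (Complex (-d) R) (Complex (-d) (-R))
     +++ linepath (Complex (-d) (-R)) (Complex 0 (-R))"

lemma valid_path_notch: "valid_path (notch R d)"
  unfolding notch_def by (auto intro!: valid_path_join)

lemma closed_segment_horizontal:
  "a \<le> b \<Longrightarrow> closed_segment (Complex a y) (Complex b y) = {z. a \<le> Re z \<and> Re z \<le> b \<and> Im z = y}"
  "a \<le> b \<Longrightarrow> closed_segment (Complex b y) (Complex a y) = {z. a \<le> Re z \<and> Re z \<le> b \<and> Im z = y}"
  by (auto simp: closed_segment_same_Im closed_segment_eq_real_ivl)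

lemma closed_segment_vertical:
  "a \<le> b \<Longrightarrow> closed_segment (Complex x a) (Complex x b) = {z. a \<le> Im z \<and> Im z \<le> b \<and> Re z = x}"
  "a \<le> b \<Longrightarrow> closed_segment (Complex x b) (Complex x a) = {z. a \<le> Im z \<and> Im z \<le> b \<and> Re z = x}"
  by (auto simp: closed_segment_same_Re closed_segment_eq_real_ivl)

lemma path_image_notch:
  assumes "R > 0" "d > 0"
  shows "path_image (notch R d) = {z. -d \<le> Re z \<and> Re z \<le> 0 \<and> \<bar>Im z\<bar> = R} \<union> {z. Re z = -d \<and> \<bar>Im z\<bar> \<le> R}"
proof -
  have "path_image (notch R d) = closed_segment (Complex 0 R) (Complex (-d) R)
      \<union> (closed_segment (Complex (-d) R) (Complex (-d) (-R)) \<union> closed_segment (Complex (-d) (-R)) (Complex 0 (-R)))"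
    unfolding notch_def by (simp add: path_image_join)
  also have "\<dots> = {z. -d \<le> Re z \<and> Re z \<le> 0 \<and> \<bar>Im z\<bar> = R} \<union> {z. Re z = -d \<and> \<bar>Im z\<bar> \<le> R}"
    using assms closed_segment_horizontal[of "-d" 0] closed_segment_vertical[of "-R" R] by auto
  finally show ?thesis .
qed

text \<open>The primitive is \<open>Ln (-z)\<close>, whose cut is the nonnegative real axis and
  misses the notch; the cut of \<open>Ln z\<close> would cross its vertical side.\<close>

lemma has_contour_integral_inverse_notch:
  assumes "R > 0" "d > 0"
  shows "((\<lambda>z. 1 / z) has_contour_integral (\<i> * of_real pi)) (notch R d)"
proof -
  let ?S = "{z::complex. - z \<notin> \<real>\<^sub>\<le>\<^sub>0}"
  have "((\<lambda>z. 1 / z) has_contour_integral (Ln (- pathfinish (notch R d)) - Ln (- pathstart (notch R d)))) (notch R d)"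
  proof (rule contour_integral_primitive[where S = ?S])
    fix x :: complex assume "(x::complex) \<in> ?S"
    then have "x \<noteq> 0" "- x \<notin> \<real>\<^sub>\<le>\<^sub>0" by auto
    then show "((\<lambda>z. Ln (-z)) has_field_derivative 1 / x) (at x within ?S)"
      by (auto intro!: derivative_eq_intros simp: field_simps)
  next
    show "path_image (notch R d) \<subseteq> ?S"
      using assms by (auto simp: path_image_notch complex_nonpos_Reals_iff)
  qed (rule valid_path_notch)
  also have "- pathfinish (notch R d) = of_real R * \<i>"
    by (simp add: notch_def complex_eq_iff)
  also have "- pathstart (notch R d) = of_real R * (-\<i>)"
    by (simp add: notch_def complex_eq_iff)
  also have "Ln (of_real R * \<i>) = of_real (ln R) + \<i> * of_real pi / 2"
    using assms by (subst Ln_times_of_real) (auto simp: Ln_of_real)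
  also have "Ln (of_real R * (- \<i>)) = of_real (ln R) - \<i> * of_real pi / 2"
    using assms by (subst Ln_times_of_real) (auto simp: Ln_of_real)
  finally show ?thesis by simp
qed

text \<open>A path whose integral of \<open>1 / z\<close> is \<open>2 \<pi> \<i>\<close> has winding number 1; splitting it at the
  two points \<open>\<plusminus>\<i> R\<close> lets the two halves be estimated separately.\<close>
lemma Cauchy_two_halves:
  assumes g: "g holomorphic_on S" and S: "convex S" "open S" "0 \<in> S"
    and v: "valid_path p" "valid_path q" "pathfinish p = pathstart q" "pathfinish q = pathstart p"
    and im: "path_image p \<subseteq> S - {0}" "path_image q \<subseteq> S - {0}"
    and p: "((\<lambda>z. 1 / z) has_contour_integral (\<i> * of_real pi)) p"
    and q: "((\<lambda>z. 1 / z) has_contour_integral (\<i> * of_real pi)) q"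
  shows "contour_integral p (\<lambda>z. g z / z) + contour_integral q (\<lambda>z. g z / z) = 2 * of_real pi * \<i> * g 0"
    and "(\<lambda>z. g z / z) contour_integrable_on p" "(\<lambda>z. g z / z) contour_integrable_on q"
proof -
  have v': "valid_path (p +++ q)" using v by (simp add: valid_path_join)
  have im': "path_image (p +++ q) \<subseteq> S - {0}" using im v by (simp add: path_image_join)
  have "((\<lambda>z. 1 / z) has_contour_integral (\<i> * of_real pi + \<i> * of_real pi)) (p +++ q)"
    using p q v by (intro has_contour_integral_join) auto
  then have "winding_number (p +++ q) 0 = 1"
    using v' im' by (subst winding_number_valid_path) (auto simp: contour_integral_unique)
  then have hc: "((\<lambda>z. g z / (z - 0)) has_contour_integral (2 * of_real pi * \<i> * 1 * g 0)) (p +++ q)"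
    using Cauchy_integral_formula_convex_simple[OF S(1) g, of 0 "p +++ q"] v v' im' S
    by (simp add: interior_open)
  have "(\<lambda>z. g z / z) holomorphic_on (S - {0})"
    using g by (auto intro!: holomorphic_intros elim: holomorphic_on_subset)
  then have *: "(\<lambda>z. g z / z) contour_integrable_on r" if "valid_path r" "path_image r \<subseteq> S - {0}" for r
    using contour_integrable_holomorphic_simple[of _ "S - {0}" r] that S by auto
  show i: "(\<lambda>z. g z / z) contour_integrable_on p" "(\<lambda>z. g z / z) contour_integrable_on q"
    using * v im by auto
  show "contour_integral p (\<lambda>z. g z / z) + contour_integral q (\<lambda>z. g z / z) = 2 * of_real pi * \<i> * g 0"
    using contour_integral_unique[OF hc] contour_integral_join[OF i v(1,2)] v by simp
qed

section \<open>Newman's analytic theorem\<close>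

text \<open>On the circle R^2 is z times its conjugate, so R^2 + z^2 = z (cnj z + z), and the second
  factor is 2 Re z.\<close>

lemma kernel_on_circle:
  assumes "norm z = R" "R > 0"
  shows "norm ((1 + z\<^sup>2 / of_real R ^ 2) / z) = 2 * \<bar>Re z\<bar> / R\<^sup>2"
proof -
  have "z * cnj z = of_real R ^ 2"
    using complex_norm_square[of z] assms by simp
  then have "(1 + z\<^sup>2 / of_real R ^ 2) / z = (z * cnj z + z * z) / (z * of_real R ^ 2)"
    using assms by (auto simp: field_simps power2_eq_square)
  also have "\<dots> = (cnj z + z) / of_real R ^ 2"
    using assms by (auto simp: field_simps)
  also have "cnj z + z = of_real (2 * Re z)" by (simp add: complex_eq_iff)
  finally show ?thesis using assms by (simp add: norm_divide norm_power abs_mult)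
qed

lemma holomorphic_of_nat_powr [holomorphic_intros]:
  assumes "n > 0" "g holomorphic_on A"
  shows "(\<lambda>z. (of_nat n :: complex) powr g z) holomorphic_on A"
  using assms by (auto simp: powr_def intro!: holomorphic_intros)

text \<open>With x = -Re z the sum is at most N^x (1/N + 1/x), and \<open>of_nat N powr z\<close>
  has norm N^(-x). Being finite, the sum is entire, so it can be estimated in the left half plane,
  where the full series need not converge.\<close>

lemma newman_partial_sum_bound:
  assumes b: "\<And>k. k \<ge> 1 \<Longrightarrow> norm (b k :: complex) \<le> 1 / real k" and N: "N \<ge> (1::nat)" and z: "Re z < 0"
  shows "norm ((\<Sum>k=1..N. b k * of_nat k powr (-z)) * of_nat N powr z) \<le> 1 / real N + 1 / \<bar>Re z\<bar>"
proof -
  define x where "x = - Re z"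
  have x: "x > 0" using z by (simp add: x_def)
  have "norm (\<Sum>k=1..N. b k * of_nat k powr (-z)) \<le> (\<Sum>k=1..N. real k powr (x - 1))"
  proof (rule sum_norm_le)
    fix k assume k: "k \<in> {1..N}"
    then have "norm (b k * of_nat k powr (-z)) \<le> 1 / real k * real k powr x"
      unfolding norm_mult using b[of k] by (intro mult_mono) (auto simp: norm_of_nat_powr x_def)
    also have "\<dots> = real k powr (x - 1)" using k by (simp add: powr_diff)
    finally show "norm (b k * of_nat k powr (-z)) \<le> real k powr (x - 1)" .
  qed
  also have "\<dots> \<le> real N powr (x - 1) + real N powr x / x" by (rule sum_powr_head[OF x N])
  also have "\<dots> = real N powr x * (1 / real N + 1 / x)"
    using N x by (simp add: powr_diff field_simps)
  finally have "norm (\<Sum>k=1..N. b k * of_nat k powr (-z)) * real N powr (-x)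
      \<le> real N powr x * (1 / real N + 1 / x) * real N powr (-x)"
    by (rule mult_right_mono) auto
  also have "\<dots> = 1 / real N + 1 / x"
    using N by (simp add: powr_minus field_simps)
  finally show ?thesis using N x by (simp add: norm_mult norm_of_nat_powr x_def)
qed

text \<open>The mirror image of the preceding bound: for x = Re z > 0 the tail is at most N^(-x) /
  x, and \<open>of_nat N powr z\<close> now has norm N^x.\<close>

lemma newman_tail_bound:
  assumes b: "\<And>k. k \<ge> 1 \<Longrightarrow> norm (b k :: complex) \<le> 1 / real k" and N: "N \<ge> (1::nat)" and z: "Re z > 0"
    and F: "(\<lambda>k. b (Suc k) * of_nat (Suc k) powr (-z)) sums F"
  shows "norm ((F - (\<Sum>k=1..N. b k * of_nat k powr (-z))) * of_nat N powr z) \<le> 1 / \<bar>Re z\<bar>"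
proof -
  define x where "x = Re z"
  have x: "x > 0" using z by (simp add: x_def)
  let ?t = "\<lambda>k. b (Suc k) * of_nat (Suc k) powr (-z)"
  have "(\<lambda>k. ?t (k + N)) sums (F - (\<Sum>k<N. ?t k))"
    by (rule sums_split_initial_segment[OF F])
  also have "(\<Sum>k<N. ?t k) = (\<Sum>k=1..N. b k * of_nat k powr (-z))"
    by (rule sum.reindex_bij_witness[of _ "\<lambda>k. k - 1" Suc]) auto
  finally have lim: "(\<lambda>m. \<Sum>k<m. ?t (k + N)) \<longlonglongrightarrow> F - (\<Sum>k=1..N. b k * of_nat k powr (-z))"
    by (simp add: sums_def)
  have "norm (F - (\<Sum>k=1..N. b k * of_nat k powr (-z))) \<le> real N powr (-x) / x"
  proof (rule Lim_norm_ubound[OF _ lim])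
    show "\<forall>\<^sub>F m in sequentially. norm (\<Sum>k<m. ?t (k + N)) \<le> real N powr (-x) / x"
    proof (intro always_eventually allI)
      fix m
      have "norm (\<Sum>k<m. ?t (k + N)) \<le> (\<Sum>k<m. real (Suc (N + k)) powr (-1 - x))"
      proof (rule sum_norm_le)
        fix k
        have "norm (?t (k + N)) \<le> 1 / real (Suc (k + N)) * real (Suc (k + N)) powr (-x)"
          unfolding norm_mult using b[of "Suc (k + N)"]
          by (intro mult_mono) (simp_all only: norm_of_nat_powr x_def, auto)
        also have "\<dots> = real (Suc (N + k)) powr (-1 - x)"
          by (simp add: powr_diff powr_minus field_simps)
        finally show "norm (?t (k + N)) \<le> real (Suc (N + k)) powr (-1 - x)" .
      qed
      also have "\<dots> \<le> (real N powr (-x) - real (N + m) powr (-x)) / x"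
        by (rule sum_powr_tail[OF x N])
      also have "\<dots> \<le> real N powr (-x) / x" using x by (intro divide_right_mono) auto
      finally show "norm (\<Sum>k<m. ?t (k + N)) \<le> real N powr (-x) / x" .
    qed
  qed simp
  then have "norm (F - (\<Sum>k=1..N. b k * of_nat k powr (-z))) * real N powr x \<le> real N powr (-x) / x * real N powr x"
    by (rule mult_right_mono) auto
  also have "\<dots> = 1 / x" using N by (simp add: powr_minus field_simps)
  finally show ?thesis using N x by (simp add: norm_mult norm_of_nat_powr x_def)
qed

text \<open>Each point of the imaginary axis has its own room in \<open>U\<close>; compactness of a
  segment of that axis makes the room uniform as long as the height stays bounded.\<close>

lemma open_strip_in_neighbourhood:
  assumes "open U" "{z. 0 \<le> Re z} \<subseteq> U"
  obtains e where "e > 0" "{z. - e < Re z \<and> \<bar>Im z\<bar> < B} \<subseteq> U"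
proof -
  have "compact (cbox (Complex 0 (-B)) (Complex 0 B))" by (rule compact_cbox)
  moreover have "cbox (Complex 0 (-B)) (Complex 0 B) \<subseteq> U"
    using assms(2) by (auto simp: in_cbox_complex_iff)
  ultimately obtain e where e: "e > 0" "(\<Union>x\<in>cbox (Complex 0 (-B)) (Complex 0 B). ball x e) \<subseteq> U"
    using compact_subset_open_imp_ball_epsilon_subset assms(1) by metis
  have "z \<in> U" if "- e < Re z" "\<bar>Im z\<bar> < B" for z
  proof (cases "Re z \<ge> 0")
    case False
    have "z - Complex 0 (Im z) = of_real (Re z)" by (simp add: complex_eq_iff)
    then have "z \<in> ball (Complex 0 (Im z)) e"
      using that False by (simp add: dist_norm norm_minus_commute[of "Complex 0 (Im z)"])
    moreover have "Complex 0 (Im z) \<in> cbox (Complex 0 (-B)) (Complex 0 B)"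
      using that by (auto simp: in_cbox_complex_iff)
    ultimately show ?thesis using e by blast
  qed (use assms in auto)
  then show ?thesis using that e(1) by blast
qed

lemma arc_right:
  assumes "z \<in> path_image (part_circlepath 0 R (-(pi/2)) (pi/2))" "R > 0"
  shows "norm z = R" "Re z \<ge> 0"
proof -
  obtain t where t: "-(pi/2) \<le> t" "t \<le> pi/2" "z = of_real R * cis t"
    using assms by (auto simp: path_image_part_circlepath cis_conv_exp mult.commute)
  then show "norm z = R" "Re z \<ge> 0" using assms by (auto simp: norm_mult cos_ge_zero)
qed

lemma arc_left:
  assumes "z \<in> path_image (part_circlepath 0 R (pi/2) (3*pi/2))" "R > 0"
  shows "norm z = R" "Re z \<le> 0"
proof -
  obtain t where t: "pi/2 \<le> t" "t \<le> 3*pi/2" "z = of_real R * cis t"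
    using assms by (auto simp: path_image_part_circlepath cis_conv_exp mult.commute)
  have "0 \<le> cos (t - pi)" using t by (intro cos_ge_zero) auto
  then have "cos t \<le> 0" by (simp add: cos_diff)
  then show "norm z = R" "Re z \<le> 0" using assms t by (auto simp: norm_mult mult_nonneg_nonpos)
qed

lemma arc_endpoints:
  "pathstart (part_circlepath 0 R (-(pi/2)) (pi/2)) = Complex 0 (-R)"
  "pathfinish (part_circlepath 0 R (-(pi/2)) (pi/2)) = Complex 0 R"
  "pathstart (part_circlepath 0 R (pi/2) (3*pi/2)) = Complex 0 R"
  "pathfinish (part_circlepath 0 R (pi/2) (3*pi/2)) = Complex 0 (-R)"
  by (simp_all add: cis_conv_exp[symmetric] complex_eq_iff cos_3over2_pi[simplified] sin_3over2_pi[simplified]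
      del: of_real_minus of_real_divide of_real_mult flip: of_real_minus of_real_divide of_real_mult)

text \<open>Newman's analytic theorem. On the arc the factor \<open>1 / z + z / R\<^sup>2\<close> equals
  \<open>2 Re z / R\<^sup>2\<close>, which absorbs the \<open>1 / Re z\<close> in the bounds for tail and partial sum.\<close>
lemma newman:
  fixes b :: "nat \<Rightarrow> complex"
  assumes b: "\<And>k. k \<ge> 1 \<Longrightarrow> norm (b k) \<le> 1 / real k"
    and U: "open U" "{z. 0 \<le> Re z} \<subseteq> U" and F: "F holomorphic_on U"
    and sums: "\<And>z. Re z > 0 \<Longrightarrow> (\<lambda>k. b (Suc k) * of_nat (Suc k) powr (-z)) sums F z"
  shows "(\<lambda>k. b (Suc k)) sums F 0"
proof -
  define S where "S = (\<lambda>N z. \<Sum>k=1..N::nat. b k * of_nat k powr (-z))"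
  have S_hol: "S N holomorphic_on A" for N A
    unfolding S_def by (intro holomorphic_intros) auto
  have "(\<lambda>N. S N 0) \<longlonglongrightarrow> F 0"
  proof (rule LIMSEQ_I)
    fix \<epsilon> :: real assume eps: "\<epsilon> > 0"
    \<comment> \<open>The final error is 2 pi times the sum of 2 / R, d M and 1 / N + M' N^(-d) R.
      The choice of R makes the first of these smaller than \<epsilon>/5; d and N0 are chosen below
      to do the same for the other two.\<close>
    define R where "R = 1 + 10 / \<epsilon>"
    have R: "R > 0" "R \<ge> 1" "2 / R < \<epsilon> / 5" using eps by (auto simp: R_def field_simps add_pos_pos)
    obtain e where e: "e > 0" "{z. - e < Re z \<and> \<bar>Im z\<bar> < R + 1} \<subseteq> U"
      using open_strip_in_neighbourhood[OF U] by blast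
    define C where "C = {z. - e < Re z \<and> \<bar>Im z\<bar> < R + 1}"
    have CU: "C \<subseteq> U" using e by (simp add: C_def)
    have C_eq: "C = {z. - e < Re z} \<inter> {z. - (R + 1) < Im z} \<inter> {z. Im z < R + 1}"
      by (auto simp: C_def)
    have C: "convex C" "open C" "0 \<in> C"
      unfolding C_eq using R e
      by (auto intro!: convex_Int open_Int convex_halfspace_Re_gt convex_halfspace_Im_gt convex_halfspace_Im_lt
          open_halfspace_Re_gt open_halfspace_Im_gt open_halfspace_Im_lt)
    \<comment> \<open>The value 1 at 0 leaves Cauchy's formula at 0 unchanged, while the zeros at iR
      and -iR tame the integrand where the arcs meet the imaginary axis.\<close>
    define K where "K = (\<lambda>z::complex. 1 + z\<^sup>2 / of_real R ^ 2)"
    have K_hol: "K holomorphic_on A" for A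
      unfolding K_def using R by (intro holomorphic_intros) auto
    define FK where "FK = (\<lambda>z. F z * K z / z)"
    have FK_cont: "continuous_on A FK" if "A \<subseteq> C - {0}" for A
    proof -
      have "FK holomorphic_on A" unfolding FK_def using that CU
        by (intro holomorphic_intros K_hol holomorphic_on_subset[OF F]) auto
      then show ?thesis by (rule holomorphic_on_imp_continuous_on)
    qed
    \<comment> \<open>The horizontal sides of every notch with d at most e/2 lie in this one compact
      set, so M is fixed before d, and d can then be shrunk until d M is small. The bound M' for the
      vertical side does depend on d, but there the factor N^(-d) tends to 0 as N grows.\<close>
    have "compact (FK ` {z\<in>cbox (Complex (-e/2) (-R)) (Complex 0 R). \<bar>Im z\<bar> = R})"
    proof (intro compact_continuous_image FK_cont)
      have "{z\<in>cbox (Complex (-e/2) (-R)) (Complex 0 R). \<bar>Im z\<bar> = R} =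
          cbox (Complex (-e/2) R) (Complex 0 R) \<union> cbox (Complex (-e/2) (-R)) (Complex 0 (-R))"
        using R by (auto simp: in_cbox_complex_iff)
      then show "compact {z\<in>cbox (Complex (-e/2) (-R)) (Complex 0 R). \<bar>Im z\<bar> = R}"
        by (simp add: compact_Un)
      show "{z\<in>cbox (Complex (-e/2) (-R)) (Complex 0 R). \<bar>Im z\<bar> = R} \<subseteq> C - {0}"
        using R e by (auto simp: in_cbox_complex_iff C_def)
    qed
    then have "bounded (FK ` {z\<in>cbox (Complex (-e/2) (-R)) (Complex 0 R). \<bar>Im z\<bar> = R})"
      by (rule compact_imp_bounded)
    then obtain M where "M > 0" and
      M': "\<And>x. x \<in> FK ` {z\<in>cbox (Complex (-e/2) (-R)) (Complex 0 R). \<bar>Im z\<bar> = R} \<Longrightarrow> norm x \<le> M"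
      unfolding bounded_pos by blast
    have M: "norm (FK z) \<le> M" if "-e/2 \<le> Re z" "Re z \<le> 0" "\<bar>Im z\<bar> = R" for z
      using that by (auto intro!: M' imageI simp: in_cbox_complex_iff)
    define d where "d = min (e/2) (\<epsilon> / (5 * M))"
    have d: "d > 0" "d \<le> e/2" "d < e" "d * M \<le> \<epsilon> / 5"
      using e eps \<open>M > 0\<close> by (auto simp: d_def min_def field_simps)
    have "compact (FK ` cbox (Complex (-d) (-R)) (Complex (-d) R))"
      using d R by (intro compact_continuous_image FK_cont) (auto simp: in_cbox_complex_iff C_def)
    then have "bounded (FK ` cbox (Complex (-d) (-R)) (Complex (-d) R))"
      by (rule compact_imp_bounded)
    then obtain M' where M': "M' > 0" "\<And>z. Re z = -d \<Longrightarrow> \<bar>Im z\<bar> \<le> R \<Longrightarrow> norm (FK z) \<le> M'"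
      unfolding bounded_pos by (force simp: in_cbox_complex_iff)
    have "(\<lambda>N. 1 / real N + M' * real N powr (-d) * R) \<longlonglongrightarrow> 0 + M' * 0 * R"
      using d by (intro tendsto_intros lim_1_over_n tendsto_neg_powr filterlim_real_sequentially) auto
    then have "\<forall>\<^sub>F N in sequentially. 1 / real N + M' * real N powr (-d) * R < \<epsilon> / 5"
      using eps by (intro order_tendstoD) auto
    then obtain N0 where N0: "\<And>N. N \<ge> N0 \<Longrightarrow> 1 / real N + M' * real N powr (-d) * R < \<epsilon> / 5"
      by (auto simp: eventually_sequentially)
    show "\<exists>N0. \<forall>N\<ge>N0. norm (S N 0 - F 0) < \<epsilon>"
    proof (intro exI allI impI)
      fix N assume "N \<ge> max 1 N0"
      then have N: "N \<ge> 1" "N \<ge> N0" by auto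
      let ?A = "part_circlepath 0 R (-(pi/2)) (pi/2)"
      let ?L = "part_circlepath 0 R (pi/2) (3*pi/2)"
      let ?B = "notch R d"
      define P where "P = (\<lambda>z. of_nat N powr z * K z)"
      have P_hol: "P holomorphic_on A" for A
        unfolding P_def using N by (intro holomorphic_intros K_hol) auto
      have P0: "P 0 = 1" using N by (simp add: P_def K_def)
      have P_norm: "norm (P z / z) = real N powr Re z * (2 * \<bar>Re z\<bar> / R\<^sup>2)" if "norm z = R" for z
      proof -
        have "P z / z = of_nat N powr z * ((1 + z\<^sup>2 / of_real R ^ 2) / z)"
          by (simp add: P_def K_def)
        then show ?thesis
          using N by (simp only: norm_mult kernel_on_circle[OF that R(1)] norm_of_nat_powr)
      qed
      have ints: "((\<lambda>z. 1 / z) has_contour_integral (\<i> * of_real pi)) ?A"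
          "((\<lambda>z. 1 / z) has_contour_integral (\<i> * of_real pi)) ?L"
          "((\<lambda>z. 1 / z) has_contour_integral (\<i> * of_real pi)) ?B"
        using has_contour_integral_inverse_arc[of R "-(pi/2)" "pi/2"]
          has_contour_integral_inverse_arc[of R "pi/2" "3*pi/2"]
          has_contour_integral_inverse_notch[of R d] R d by simp_all
      have imgA: "path_image ?A \<subseteq> C - {0}"
      proof
        fix z assume "z \<in> path_image ?A"
        from arc_right[OF this R(1)] show "z \<in> C - {0}"
          using R e abs_Im_le_cmod[of z] by (auto simp: C_def)
      qed
      have imgL: "path_image ?L \<subseteq> UNIV - {0}" using arc_left(1)[OF _ R(1)] R by fastforce
      have imgB: "path_image ?B \<subseteq> C - {0}"
        using R d by (auto simp: path_image_notch C_def)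
      have ends: "pathfinish ?B = Complex 0 (-R)" "pathstart ?B = Complex 0 R"
        by (simp_all add: notch_def)
      have hol1: "(\<lambda>z. F z * P z) holomorphic_on C"
        by (intro holomorphic_intros P_hol holomorphic_on_subset[OF F] CU)
      have hol2: "(\<lambda>z. S N z * P z) holomorphic_on UNIV"
        by (intro holomorphic_intros P_hol S_hol)
      have m1: "pathfinish ?A = pathstart ?B" "pathfinish ?B = pathstart ?A"
          and m2: "pathfinish ?A = pathstart ?L" "pathfinish ?L = pathstart ?A"
        by (simp_all only: arc_endpoints ends)
      have imgA': "path_image ?A \<subseteq> UNIV - {0}" using imgA by blast
      \<comment> \<open>F is integrated over the right arc and the notch, the entire function
        \<open>S N\<close> over the full circle. On the right arc the two integrands combine to the
        tail \<open>F - S N\<close>, which is small there; on the left, each is estimated alone on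
        its own contour.\<close>
      note c1 = Cauchy_two_halves[OF hol1 C valid_path_part_circlepath valid_path_notch m1 imgA imgB ints(1,3)]
      note c2 = Cauchy_two_halves[OF hol2 convex_UNIV open_UNIV UNIV_I valid_path_part_circlepath
          valid_path_part_circlepath m2 imgA' imgL ints(1,2)]
      have "2 * of_real pi * \<i> * (S N 0 - F 0) = 2 * of_real pi * \<i> * (S N 0 * P 0) - 2 * of_real pi * \<i> * (F 0 * P 0)"
        by (simp add: P0 right_diff_distrib)
      also have "\<dots> = contour_integral ?L (\<lambda>z. S N z * P z / z)
          - (contour_integral ?A (\<lambda>z. F z * P z / z) - contour_integral ?A (\<lambda>z. S N z * P z / z))
          - contour_integral ?B (\<lambda>z. F z * P z / z)"
        unfolding c1(1)[symmetric] c2(1)[symmetric] by simp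
      also have "contour_integral ?A (\<lambda>z. F z * P z / z) - contour_integral ?A (\<lambda>z. S N z * P z / z) =
          contour_integral ?A (\<lambda>z. F z * P z / z - S N z * P z / z)"
        by (rule contour_integral_diff[OF c1(2) c2(2), symmetric])
      finally have "2 * of_real pi * \<i> * (S N 0 - F 0) = contour_integral ?L (\<lambda>z. S N z * P z / z)
          - contour_integral ?A (\<lambda>z. F z * P z / z - S N z * P z / z) - contour_integral ?B (\<lambda>z. F z * P z / z)" .
      then have "norm (2 * of_real pi * \<i> * (S N 0 - F 0)) \<le> norm (contour_integral ?L (\<lambda>z. S N z * P z / z))
          + norm (contour_integral ?A (\<lambda>z. F z * P z / z - S N z * P z / z)) + norm (contour_integral ?B (\<lambda>z. F z * P z / z))"
        using norm_triangle_ineq4[of "contour_integral ?L (\<lambda>z. S N z * P z / z)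
          - contour_integral ?A (\<lambda>z. F z * P z / z - S N z * P z / z)" "contour_integral ?B (\<lambda>z. F z * P z / z)"]
          norm_triangle_ineq4[of "contour_integral ?L (\<lambda>z. S N z * P z / z)" "contour_integral ?A (\<lambda>z. F z * P z / z - S N z * P z / z)"]
        by simp
      \<comment> \<open>The end points of the arc are excepted because the tail bound contains 1 /
        |Re z|; finitely many points do not affect the integral.\<close>
      moreover have "norm (contour_integral ?A (\<lambda>z. F z * P z / z - S N z * P z / z)) \<le> 2 / R\<^sup>2 * R * (pi/2 - -(pi/2))"
      proof (rule contour_integral_bound_part_circlepath_strong[where k = "{Complex 0 R, Complex 0 (-R)}"])
        fix z assume z: "z \<in> path_image ?A - {Complex 0 R, Complex 0 (-R)}"
        then have "norm z = R" "Re z \<ge> 0" using arc_right[of z R] R by auto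
        moreover have "Re z \<noteq> 0"
          using z \<open>norm z = R\<close> R by (cases z) (auto simp: complex_norm abs_if split: if_splits)
        ultimately have zr: "norm z = R" "Re z > 0" by auto
        have "F z * P z / z - S N z * P z / z = (F z - S N z) * (P z / z)"
          by (simp add: algebra_simps diff_divide_distrib)
        also have "norm \<dots> = norm ((F z - S N z) * of_nat N powr z) * (2 * \<bar>Re z\<bar> / R\<^sup>2)"
          using N by (simp only: norm_mult P_norm[OF zr(1)] norm_of_nat_powr mult.assoc)
        also have "\<dots> \<le> 1 / \<bar>Re z\<bar> * (2 * \<bar>Re z\<bar> / R\<^sup>2)"
          unfolding S_def by (intro mult_right_mono newman_tail_bound b N sums zr) auto
        also have "\<dots> = 2 / R\<^sup>2" using zr R by simp
        finally show "norm (F z * P z / z - S N z * P z / z) \<le> 2 / R\<^sup>2" .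
      qed (use R c1 c2 in \<open>auto intro!: contour_integrable_diff\<close>)
      moreover have "norm (contour_integral ?L (\<lambda>z. S N z * P z / z)) \<le> (2 / R\<^sup>2 + 2 / (R * real N)) * R * (3*pi/2 - pi/2)"
      proof (rule contour_integral_bound_part_circlepath_strong[where k = "{Complex 0 R, Complex 0 (-R)}"])
        fix z assume z: "z \<in> path_image ?L - {Complex 0 R, Complex 0 (-R)}"
        then have "norm z = R" "Re z \<le> 0" using arc_left[of z R] R by auto
        moreover have "Re z \<noteq> 0"
          using z \<open>norm z = R\<close> R by (cases z) (auto simp: complex_norm abs_if split: if_splits)
        ultimately have zr: "norm z = R" "Re z < 0" by auto
        have "norm (S N z * P z / z) = norm (S N z * (P z / z))" by simp
        also have "\<dots> = norm (S N z * of_nat N powr z) * (2 * \<bar>Re z\<bar> / R\<^sup>2)"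
          using N by (simp only: norm_mult P_norm[OF zr(1)] norm_of_nat_powr mult.assoc)
        also have "\<dots> \<le> (1 / real N + 1 / \<bar>Re z\<bar>) * (2 * \<bar>Re z\<bar> / R\<^sup>2)"
          unfolding S_def by (intro mult_right_mono newman_partial_sum_bound b N zr) auto
        also have "\<dots> = 2 / R\<^sup>2 + \<bar>Re z\<bar> * (2 / (R\<^sup>2 * real N))"
          using zr R N by (simp add: field_simps)
        also have "\<dots> \<le> 2 / R\<^sup>2 + R * (2 / (R\<^sup>2 * real N))"
          using abs_Re_le_cmod[of z] zr by (intro add_left_mono mult_right_mono) auto
        also have "R * (2 / (R\<^sup>2 * real N)) = 2 / (R * real N)"
          using R by (simp add: power2_eq_square)
        finally show "norm (S N z * P z / z) \<le> 2 / R\<^sup>2 + 2 / (R * real N)" .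
      qed (use R c1 c2 in auto)
      moreover have "norm (contour_integral ?B (\<lambda>z. F z * P z / z)) \<le> M * d + (M' * real N powr (-d) * (2 * R) + M * d)"
      proof -
        let ?s1 = "linepath (Complex 0 R) (Complex (-d) R)"
        let ?s2 = "linepath (Complex (-d) R) (Complex (-d) (-R))"
        let ?s3 = "linepath (Complex (-d) (-R)) (Complex 0 (-R))"
        let ?f = "\<lambda>z. F z * P z / z"
        have nf: "norm (?f z) = norm (FK z) * real N powr Re z" for z
          using N by (simp add: P_def FK_def norm_mult norm_divide norm_of_nat_powr)
        have hor: "norm (?f z) \<le> M" if "- d \<le> Re z" "Re z \<le> 0" "\<bar>Im z\<bar> = R" for z
        proof -
          have "real N powr Re z \<le> 1" using N that powr_mono[of "Re z" 0 "real N"] by simp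
          then have "norm (FK z) * real N powr Re z \<le> M * 1"
            using M[of z] that d \<open>M > 0\<close> by (intro mult_mono) auto
          then show ?thesis by (simp only: nf)
        qed
        have i: "?f contour_integrable_on ?s1" "?f contour_integrable_on ?s2" "?f contour_integrable_on ?s3"
          using c1(3) unfolding notch_def by (auto simp: contour_integrable_join)
        have "contour_integral ?B ?f = contour_integral ?s1 ?f + (contour_integral ?s2 ?f + contour_integral ?s3 ?f)"
          unfolding notch_def using i by simp
        moreover have "norm (contour_integral ?s1 ?f) \<le> M * norm (Complex (-d) R - Complex 0 R)"
          using i \<open>M > 0\<close> d R
          by (intro contour_integral_bound_linepath hor) (auto simp: closed_segment_horizontal)
        moreover have "norm (contour_integral ?s2 ?f) \<le> M' * real N powr (-d) * norm (Complex (-d) (-R) - Complex (-d) R)"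
        proof (intro contour_integral_bound_linepath i)
          fix z assume "z \<in> closed_segment (Complex (-d) R) (Complex (-d) (-R))"
          then have z: "Re z = -d" "\<bar>Im z\<bar> \<le> R" using R by (auto simp: closed_segment_vertical)
          show "norm (?f z) \<le> M' * real N powr (-d)"
            using M'(2)[OF z] unfolding nf z(1) by (intro mult_right_mono) auto
        qed (use M' in auto)
        moreover have "norm (contour_integral ?s3 ?f) \<le> M * norm (Complex 0 (-R) - Complex (-d) (-R))"
          using i \<open>M > 0\<close> d R
          by (intro contour_integral_bound_linepath hor) (auto simp: closed_segment_horizontal)
        ultimately have "norm (contour_integral ?B ?f) \<le> M * norm (Complex (-d) R - Complex 0 R) +
            (M' * real N powr (-d) * norm (Complex (-d) (-R) - Complex (-d) R) + M * norm (Complex 0 (-R) - Complex (-d) (-R)))"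
          by (simp only: norm_triangle_mono)
        moreover have "norm (Complex (-d) R - Complex 0 R) = d" "norm (Complex (-d) (-R) - Complex (-d) R) = 2 * R"
            "norm (Complex 0 (-R) - Complex (-d) (-R)) = d"
          using d R by (simp_all add: cmod_def real_sqrt_mult)
        ultimately show ?thesis by (simp only:)
      qed
      ultimately have "norm (2 * of_real pi * \<i> * (S N 0 - F 0)) \<le> (2 / R\<^sup>2 + 2 / (R * real N)) * R * pi
          + 2 / R\<^sup>2 * R * pi + (M * d + (M' * real N powr (-d) * (2 * R) + M * d))"
        by simp
      also have "\<dots> = 2 * pi * (2 / R + 1 / real N) + 2 * (d * M + M' * real N powr (-d) * R)"
        using R N by (simp add: field_simps power2_eq_square)
      \<comment> \<open>As 1 <= pi, the second summand may carry the factor 2 pi as well; it is the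
        norm of the factor 2 pi i on the left and cancels.\<close>
      also have "\<dots> \<le> 2 * pi * (2 / R + 1 / real N) + 2 * pi * (d * M + M' * real N powr (-d) * R)"
        using d M' R \<open>M > 0\<close> pi_gt3 by (intro add_left_mono mult_right_mono) (auto intro!: add_nonneg_nonneg)
      also have "\<dots> = 2 * pi * (2 / R + d * M + (1 / real N + M' * real N powr (-d) * R))"
        by (simp add: algebra_simps)
      also have "\<dots> < 2 * pi * \<epsilon>"
        using N0[OF N(2)] R d eps by (intro mult_strict_left_mono) auto
      finally show "norm (S N 0 - F 0) < \<epsilon>" by (simp add: norm_mult)
    qed
  qed
  moreover have "(\<Sum>k<N. b (Suc k)) = S N 0" for N
    unfolding S_def by (rule sum.reindex_bij_witness[of _ "\<lambda>k. k - 1" Suc]) (auto simp del: of_nat_Suc)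
  ultimately show ?thesis by (simp add: sums_def)
qed

section \<open>The Moebius function and the generalised Ramanujan sums\<close>

definition moebius_mu :: "nat \<Rightarrow> complex" where
  "moebius_mu n = (if squarefree n then (-1) ^ card (prime_factors n) else 0)"

lemma norm_moebius_le: "norm (moebius_mu n) \<le> 1"
  by (simp add: moebius_mu_def norm_power)

lemma moebius_prime_mult:
  assumes "prime p" "\<not> p dvd d"
  shows "moebius_mu (p * d) = - moebius_mu d"
proof -
  have "d \<noteq> 0" using assms by (metis dvd_0_right)
  have cop: "coprime p d" using assms by (simp add: prime_imp_coprime)
  have "squarefree (p * d) \<longleftrightarrow> squarefree d"
    using squarefree_mult_coprime[OF cop] squarefree_prime[OF assms(1)] squarefree_multD(2) by blast
  moreover have "prime_factors (p * d) = insert p (prime_factors d)"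
    using assms \<open>d \<noteq> 0\<close> by (simp add: prime_factors_product prime_prime_factors)
  moreover have "p \<notin> prime_factors d" using assms by auto
  ultimately show ?thesis by (simp add: moebius_mu_def)
qed

text \<open>For a prime p dividing n, divisors divisible by p^2 contribute 0, and d -> p d pairs the
  divisors prime to p with those containing p exactly once, with opposite signs.\<close>

lemma sum_moebius_divisors:
  assumes "n > 0"
  shows "(\<Sum>d | d dvd n. moebius_mu d) = (if n = 1 then 1 else 0)"
proof (cases "n = 1")
  case False
  then obtain p where p: "prime p" "p dvd n" using prime_factor_nat by blast
  let ?D = "{d. d dvd n}"
  have fin: "finite ?D" using assms by simp
  have sq: "moebius_mu d = 0" if "p * p dvd d" for d
    using that p(1) squarefreeD[of d p] prime_gt_1_nat[of p] by (auto simp: moebius_mu_def power2_eq_square)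
  have "(\<Sum>d\<in>?D. moebius_mu d) = (\<Sum>d\<in>{d\<in>?D. \<not> p dvd d} \<union> {d\<in>?D. p dvd d \<and> \<not> p * p dvd d}. moebius_mu d)"
    using fin by (intro sum.mono_neutral_right) (auto simp: sq)
  also have "\<dots> = (\<Sum>d\<in>{d\<in>?D. \<not> p dvd d}. moebius_mu d) + (\<Sum>d\<in>{d\<in>?D. p dvd d \<and> \<not> p * p dvd d}. moebius_mu d)"
    using fin by (intro sum.union_disjoint) auto
  also have "(\<Sum>d\<in>{d\<in>?D. p dvd d \<and> \<not> p * p dvd d}. moebius_mu d) = (\<Sum>d\<in>{d\<in>?D. \<not> p dvd d}. moebius_mu (p * d))"
  proof (rule sum.reindex_bij_witness[of _ "\<lambda>d. p * d" "\<lambda>d. d div p"])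
    fix d assume "d \<in> {d \<in> ?D. p dvd d \<and> \<not> p * p dvd d}"
    then obtain k where "d = p * k" "d dvd n" "\<not> p * p dvd d" by (auto elim: dvdE)
    moreover have "p \<noteq> 0" using p by auto
    ultimately show "p * (d div p) = d" "d div p \<in> {d \<in> ?D. \<not> p dvd d}" "moebius_mu (p * (d div p)) = moebius_mu d"
      by (auto dest: dvd_mult_right)
  next
    fix d assume d: "d \<in> {d \<in> ?D. \<not> p dvd d}"
    have "coprime p d" using d p by (simp add: prime_imp_coprime)
    then show "p * d \<in> {d \<in> ?D. p dvd d \<and> \<not> p * p dvd d}" "p * d div p = d"
      using d p by (auto simp: divides_mult prime_gt_0_nat)
  qed
  also have "\<dots> = (\<Sum>d\<in>{d\<in>?D. \<not> p dvd d}. - moebius_mu d)"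
    using p by (intro sum.cong) (auto simp: moebius_prime_mult)
  finally show ?thesis using False by (simp add: sum_negf)
qed (simp add: moebius_mu_def)

text \<open>The index set is closed under lcm, hence consists of the divisors of a single number,
  the lcm g of all its elements, and the classical divisor sum applies to g. This is the indicator
  of the coprimality condition in the Ramanujan sum.\<close>

lemma sum_moebius_power_divisors:
  fixes b q h :: nat
  assumes "q > 0"
  shows "(\<Sum>d | d dvd q \<and> d ^ b dvd h. moebius_mu d) = (if \<exists>d>1. d dvd q \<and> d ^ b dvd h then 0 else 1)"
proof -
  define D where "D = {d. d dvd q \<and> d ^ b dvd h}"
  define g where "g = Lcm D"
  have finD: "finite D" using assms by (simp add: D_def)
  have pow_lcm: "lcm (x ^ b) (y ^ b) = lcm x y ^ b" for x y :: nat
  proof (cases "b = 0 \<or> lcm x y = 0")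
    case False
    show ?thesis by (simp add: lcm_nat_def div_power power_mult_distrib flip: gcd_exp)
  qed (auto simp: power_0_left)
  have "finite A \<Longrightarrow> A \<subseteq> D \<Longrightarrow> Lcm A dvd q \<and> Lcm A ^ b dvd h" for A
  proof (induction rule: finite_induct)
    case (insert x A)
    then have "lcm (x ^ b) (Lcm A ^ b) dvd h" by (auto simp: D_def)
    then show ?case using insert by (auto simp: D_def pow_lcm)
  qed auto
  then have g: "g dvd q" "g ^ b dvd h" using finD by (auto simp: g_def)
  have "D = {d. d dvd g}"
  proof (intro equalityI subsetI)
    fix d assume "d \<in> {d. d dvd g}"
    then have "d dvd g" "d ^ b dvd g ^ b" by (auto simp: dvd_power_same)
    then show "d \<in> D" using g by (auto simp: D_def intro: dvd_trans)
  qed (auto simp: g_def)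
  moreover have "g > 0" using g assms by (metis dvd_0_left_iff gr0I less_numeral_extra(3))
  ultimately have "(\<Sum>d\<in>D. moebius_mu d) = (if g = 1 then 1 else 0)"
    using sum_moebius_divisors by simp
  moreover have "(\<exists>d>1. d \<in> D) \<longleftrightarrow> g \<noteq> 1"
    using \<open>D = {d. d dvd g}\<close> \<open>g > 0\<close> by (metis One_nat_def Suc_lessI dvd_1_iff_1 dvd_refl mem_Collect_eq less_not_refl2)
  ultimately show ?thesis by (auto simp: D_def)
qed

lemma sum_exp_multiples:
  fixes N n :: nat
  assumes "N > 0"
  shows "(\<Sum>k<N. exp (2 * of_real pi * \<i> * of_nat n * of_nat k / of_nat N)) = (if N dvd n then of_nat N else 0 :: complex)"
proof -
  define w where "w = exp (2 * of_real pi * \<i> * of_nat n / of_nat N :: complex)"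
  have eq: "exp (2 * of_real pi * \<i> * of_nat n * of_nat k / of_nat N) = w ^ k" for k
    unfolding w_def exp_of_nat_mult[symmetric] by (simp add: mult_ac)
  have wN: "w ^ N = 1"
    unfolding w_def exp_of_nat_mult[symmetric] using assms exp_integer_2pi[of "of_nat n"] by (simp add: mult_ac)
  have w1: "w = 1 \<longleftrightarrow> N dvd n"
  proof
    assume "w = 1"
    then obtain m :: int where "Im (2 * of_real pi * \<i> * of_nat n / of_nat N) = of_int (2 * m) * pi"
      unfolding w_def exp_eq_1 by auto
    then have "real n = of_int m * real N" using assms by (simp add: field_simps)
    then have "real_of_int (int n) = real_of_int (m * int N)" by simp
    then have "int n = m * int N" by (simp only: of_int_eq_iff)
    then have "int N dvd int n" by simp
    then show "N dvd n" by simp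
  next
    assume "N dvd n"
    then obtain m where "n = N * m" by auto
    then show "w = 1" using assms exp_integer_2pi[of "of_nat m"] by (simp add: w_def mult_ac)
  qed
  show ?thesis unfolding eq
    using wN w1 assms by (cases "w = 1") (auto simp: sum_gp_strict)
qed

text \<open>Replacing the condition on h by its Moebius sum and exchanging the sums leaves, for each
  d, the h = d^\<beta> k with k < (q/d)^\<beta>. These run through a full period of exponentials
  with denominator (q/d)^\<beta>, so they add up to (q/d)^\<beta> or to 0. Swapping d with q/d gives
  the stated form.\<close>

lemma ramanujan_sum_gen_eq:
  assumes "\<beta> \<ge> 1" "q \<ge> 1" "n \<ge> 1"
  shows "ramanujan_sum_gen \<beta> q n = (\<Sum>d | d dvd q \<and> d ^ \<beta> dvd n. of_nat (d ^ \<beta>) * moebius_mu (q div d))"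
proof -
  define Q where "Q = q ^ \<beta>"
  define e where "e = (\<lambda>h. exp (2 * of_real pi * \<i> * of_nat n * of_nat h / of_nat Q) :: complex)"
  have Q: "Q > 0" using assms by (simp add: Q_def)
  have dvdQ: "d ^ \<beta> dvd q ^ \<beta> \<longleftrightarrow> d dvd q" for d
    using assms by (simp add: pow_divides_pow_iff)
  have "ramanujan_sum_gen \<beta> q n = (\<Sum>h\<in>{h\<in>{..<Q}. \<not> (\<exists>d>1. d dvd q \<and> d ^ \<beta> dvd h)}. e h)"
    unfolding ramanujan_sum_gen_def dvdQ e_def Q_def by (intro sum.cong) auto
  also have "\<dots> = (\<Sum>h<Q. if \<not> (\<exists>d>1. d dvd q \<and> d ^ \<beta> dvd h) then e h else 0)"
    by (rule sum.inter_filter) simp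
  also have "\<dots> = (\<Sum>h<Q. (\<Sum>d | d dvd q \<and> d ^ \<beta> dvd h. moebius_mu d) * e h)"
    using assms by (intro sum.cong refl, subst sum_moebius_power_divisors) auto
  also have "\<dots> = (\<Sum>h<Q. \<Sum>d | d dvd q. if d ^ \<beta> dvd h then moebius_mu d * e h else 0)"
  proof (intro sum.cong refl)
    fix h
    have "finite {d. d dvd q}" using assms by simp
    from sum.inter_filter[OF this, of "\<lambda>d. moebius_mu d * e h" "\<lambda>d. d ^ \<beta> dvd h"]
    show "(\<Sum>d | d dvd q \<and> d ^ \<beta> dvd h. moebius_mu d) * e h = (\<Sum>d | d dvd q. if d ^ \<beta> dvd h then moebius_mu d * e h else 0)"
      by (simp add: sum_distrib_right)
  qed
  also have "\<dots> = (\<Sum>d | d dvd q. \<Sum>h<Q. if d ^ \<beta> dvd h then moebius_mu d * e h else 0)"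
    by (rule sum.swap)
  also have "\<dots> = (\<Sum>d | d dvd q. if (q div d) ^ \<beta> dvd n then of_nat ((q div d) ^ \<beta>) * moebius_mu d else 0)"
  proof (intro sum.cong refl)
    fix d assume "d \<in> {d. d dvd q}"
    then obtain c where c: "q = d * c" by auto
    have dc: "d > 0" "c > 0" using c assms by (auto intro: Nat.gr0I)
    have Qdc: "Q = d ^ \<beta> * c ^ \<beta>" by (simp add: Q_def c power_mult_distrib)
    have "(\<Sum>h<Q. if d ^ \<beta> dvd h then moebius_mu d * e h else 0) = (\<Sum>h\<in>{h\<in>{..<Q}. d ^ \<beta> dvd h}. moebius_mu d * e h)"
      by (rule sum.inter_filter[symmetric]) simp
    also have "\<dots> = (\<Sum>k<c ^ \<beta>. moebius_mu d * e (d ^ \<beta> * k))"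
      by (rule sum.reindex_bij_witness[of _ "\<lambda>k. d ^ \<beta> * k" "\<lambda>h. h div d ^ \<beta>"])
        (use dc in \<open>auto simp: Qdc div_less_iff_less_mult mult.commute elim!: dvdE\<close>)
    also have "\<dots> = moebius_mu d * (\<Sum>k<c ^ \<beta>. exp (2 * of_real pi * \<i> * of_nat n * of_nat k / of_nat (c ^ \<beta>)))"
      unfolding sum_distrib_left e_def Qdc using dc by (intro sum.cong refl) (simp add: mult_ac)
    also have "\<dots> = moebius_mu d * (if c ^ \<beta> dvd n then of_nat (c ^ \<beta>) else 0)"
      using dc by (subst sum_exp_multiples) auto
    finally show "(\<Sum>h<Q. if d ^ \<beta> dvd h then moebius_mu d * e h else 0) =
        (if (q div d) ^ \<beta> dvd n then of_nat ((q div d) ^ \<beta>) * moebius_mu d else 0)"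
      using dc by (simp add: c)
  qed
  also have "\<dots> = (\<Sum>d | d dvd q. if d ^ \<beta> dvd n then of_nat (d ^ \<beta>) * moebius_mu (q div d) else 0)"
    by (rule sum.reindex_bij_witness[of _ "\<lambda>d. q div d" "\<lambda>d. q div d"]) (use assms in \<open>auto elim!: dvdE\<close>)
  also have "\<dots> = (\<Sum>d\<in>{d\<in>{d. d dvd q}. d ^ \<beta> dvd n}. of_nat (d ^ \<beta>) * moebius_mu (q div d))"
    by (rule sum.inter_filter[symmetric]) (use assms in simp)
  finally show ?thesis by simp
qed

section \<open>Continuation of (s - 1) zeta(s) to Re s > 0\<close>

text \<open>The change of (s - 1) (sum of k^(-s) for k \<le> N) + N^(1-s) from N = n to N = n + 1.
  For s \<noteq> 1 it is (s - 1) times the integral of (n+1)^(-s) - t^(-s) over [n, n+1]; written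
  without a quotient, it makes sense at s = 1 too.\<close>

definition zeta_incr :: "nat \<Rightarrow> complex \<Rightarrow> complex" where
  "zeta_incr n s = (s - 1) * of_nat (Suc n) powr (-s) + of_nat (Suc n) powr (1 - s) - of_nat n powr (1 - s)"

text \<open>\<open>(s - 1) \<zeta>(s)\<close>, as the limit of \<open>(s - 1) * (\<Sum>k\<le>N. k powr -s) + N powr (1 - s)\<close> written as a
  telescoping series; the value at \<open>N = 1\<close> is \<open>s\<close>.\<close>
definition zeta_reg :: "complex \<Rightarrow> complex" where
  "zeta_reg s = s + (\<Sum>n. zeta_incr (Suc n) s)"

lemma norm_powr_segment:
  assumes "z \<in> closed_segment (of_nat n) (of_nat (Suc n))" "n \<ge> 1"
  shows "z \<notin> \<real>\<^sub>\<le>\<^sub>0" "Re z \<ge> real n" "norm (z powr w) = Re z powr Re w"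
proof -
  obtain u where u: "0 \<le> u" "u \<le> 1" "z = of_real (real n + u)"
    using assms(1) by (auto simp: in_segment scaleR_conv_of_real algebra_simps)
  then have "Re z \<ge> real n" "z \<in> \<real>" by auto
  then show "z \<notin> \<real>\<^sub>\<le>\<^sub>0" "Re z \<ge> real n" "norm (z powr w) = Re z powr Re w"
    using assms(2) by (auto simp: complex_nonpos_Reals_iff norm_powr_real_powr)
qed

text \<open>The mean value inequality is used twice. The increment is \<phi>(n+1) - \<phi>(n) for a
  function \<phi> whose derivative (1 - s) (x^(-s) - (n+1)^(-s)) is again a difference over at most
  unit length. The second use gains the extra power of n that makes the series summable for all Re s
  > 0.\<close>

lemma norm_zeta_incr_le:
  assumes n: "n \<ge> 1" and s: "Re s > 0"
  shows "norm (zeta_incr n s) \<le> norm (s - 1) * norm s * real n powr (-1 - Re s)"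
proof -
  let ?I = "closed_segment (of_nat n) (of_nat (Suc n)) :: complex set"
  let ?m = "of_nat (Suc n) :: complex"
  have len: "norm (?m - of_nat n) = 1" by simp
  have A: "norm (z powr (-s) - ?m powr (-s)) \<le> norm s * real n powr (-1 - Re s)" if z: "z \<in> ?I" for z
  proof -
    have "norm (z powr (-s) - ?m powr (-s)) \<le> (norm s * real n powr (-1 - Re s)) * norm (z - ?m)"
    proof (rule field_differentiable_bound[where S = ?I])
      fix x assume x: "x \<in> ?I"
      show "((\<lambda>z. z powr (-s)) has_field_derivative -s * x powr (-s - 1)) (at x within ?I)"
        using norm_powr_segment(1)[OF x n] by (auto intro!: derivative_eq_intros simp: powr_diff)
      have "Re x powr (-1 - Re s) \<le> real n powr (-1 - Re s)"
        using norm_powr_segment(2)[OF x n] n s by (intro powr_mono2') auto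
      moreover have "Re (-s - 1) = -1 - Re s" by simp
      ultimately show "norm (-s * x powr (-s - 1)) \<le> norm s * real n powr (-1 - Re s)"
        unfolding norm_mult norm_minus_cancel norm_powr_segment(3)[OF x n]
        by (intro mult_left_mono) (simp_all only:, simp)
    qed (use z in auto)
    also have "\<dots> \<le> (norm s * real n powr (-1 - Re s)) * 1"
    proof (intro mult_left_mono)
      show "norm (z - ?m) \<le> 1"
        using segment_bound(2)[OF z] by (simp add: norm_minus_commute)
    qed auto
    finally show ?thesis by simp
  qed
  let ?\<phi> = "\<lambda>x. x powr (1 - s) + (s - 1) * x * ?m powr (-s)"
  have "norm (?\<phi> ?m - ?\<phi> (of_nat n)) \<le> (norm (s - 1) * (norm s * real n powr (-1 - Re s))) * norm (?m - of_nat n)"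
  proof (rule field_differentiable_bound[where S = ?I])
    fix x assume x: "x \<in> ?I"
    have e: "1 - s - 1 = -s" by simp
    show "(?\<phi> has_field_derivative (1 - s) * (x powr (-s) - ?m powr (-s))) (at x within ?I)"
      using norm_powr_segment(1)[OF x n] e by (auto intro!: derivative_eq_intros simp: algebra_simps simp del: of_nat_Suc)
    show "norm ((1 - s) * (x powr (-s) - ?m powr (-s))) \<le> norm (s - 1) * (norm s * real n powr (-1 - Re s))"
      unfolding norm_mult norm_minus_commute[of 1 s] by (intro mult_left_mono A x) auto
  qed auto
  also have "?\<phi> ?m - ?\<phi> (of_nat n) = zeta_incr n s"
    by (simp add: zeta_incr_def algebra_simps)
  finally show ?thesis by (simp add: len mult.assoc del: of_nat_Suc)
qed

lemma sum_zeta_incr: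
  "s + (\<Sum>n<m. zeta_incr (Suc n) s) = (s - 1) * (\<Sum>k<Suc m. of_nat (Suc k) powr (-s)) + of_nat (Suc m) powr (1 - s)"
proof (induction m)
  case (Suc m)
  have "s + (\<Sum>n<Suc m. zeta_incr (Suc n) s) = (s + (\<Sum>n<m. zeta_incr (Suc n) s)) + zeta_incr (Suc m) s"
    by simp
  also have "\<dots> = (s - 1) * ((\<Sum>k<Suc m. of_nat (Suc k) powr (-s)) + of_nat (Suc (Suc m)) powr (-s)) + of_nat (Suc (Suc m)) powr (1 - s)"
    unfolding Suc.IH zeta_incr_def[of "Suc m"] by (simp add: distrib_left del: of_nat_Suc sum.lessThan_Suc)
  finally show ?case by simp
qed simp

lemma zeta_reg_uniform_limit:
  assumes "Re z > 0"
  shows "\<exists>d>0. cball z d \<subseteq> {s. Re s > 0} \<and>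
     uniform_limit (cball z d) (\<lambda>m s. s + (\<Sum>n<m. zeta_incr (Suc n) s)) zeta_reg sequentially"
proof -
  \<comment> \<open>With half of Re z as radius, the radius itself is a lower bound for Re s on the
    ball, which gives a summable majorant.\<close>
  define d where "d = Re z / 2"
  have d: "d > 0" using assms by (simp add: d_def)
  have re: "Re s \<ge> d" if "s \<in> cball z d" for s
    using that abs_Re_le_cmod[of "z - s"] by (simp add: dist_norm d_def)
  define B where "B = norm z + d + 1"
  have B: "norm s \<le> B" "norm (s - 1) \<le> B" if "s \<in> cball z d" for s
    using that norm_triangle_ineq2[of s z] norm_triangle_ineq4[of s 1] by (auto simp: dist_norm B_def norm_minus_commute)
  have "uniform_limit (cball z d) (\<lambda>m s. \<Sum>n<m. zeta_incr (Suc n) s) (\<lambda>s. \<Sum>n. zeta_incr (Suc n) s) sequentially"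
  proof (rule Weierstrass_m_test)
    fix n s assume s: "s \<in> cball z d"
    have "B \<ge> 0" using B(1)[OF s] norm_ge_zero order_trans by blast
    have "norm (zeta_incr (Suc n) s) \<le> norm (s - 1) * norm s * real (Suc n) powr (-1 - Re s)"
      using re[OF s] d by (intro norm_zeta_incr_le) auto
    also have "\<dots> \<le> B * B * real (Suc n) powr (-1 - d)"
      using B[OF s] re[OF s] \<open>B \<ge> 0\<close> by (intro mult_mono powr_mono) auto
    finally show "norm (zeta_incr (Suc n) s) \<le> B * B * real (Suc n) powr (-1 - d)" .
  next
    show "summable (\<lambda>n. B * B * real (Suc n) powr (-1 - d))"
      using d summable_real_powr_iff[of "-1 - d"] summable_Suc_iff[of "\<lambda>n. real n powr (-1 - d)"]
      by (intro summable_mult) auto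
  qed
  then have "uniform_limit (cball z d) (\<lambda>m s. s + (\<Sum>n<m. zeta_incr (Suc n) s)) (\<lambda>s. s + (\<Sum>n. zeta_incr (Suc n) s)) sequentially"
    by (intro uniform_limit_add uniform_limit_const)
  moreover have "(\<lambda>s. s + (\<Sum>n. zeta_incr (Suc n) s)) = zeta_reg"
    by (simp add: zeta_reg_def fun_eq_iff)
  moreover have "cball z d \<subseteq> {s. Re s > 0}" using re d by force
  ultimately show ?thesis using d by auto
qed

lemma zeta_reg_holomorphic: "zeta_reg holomorphic_on {s. Re s > 0}"
proof (rule holomorphic_uniform_sequence)
  show "(\<lambda>s. s + (\<Sum>n<m. zeta_incr (Suc n) s)) holomorphic_on {s. Re s > 0}" for m
    unfolding zeta_incr_def by (intro holomorphic_intros) auto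
qed (use zeta_reg_uniform_limit open_halfspace_Re_gt in auto)

lemma zeta_reg_lim:
  assumes "Re s > 0"
  shows "(\<lambda>m. (s - 1) * (\<Sum>k<m. of_nat (Suc k) powr (-s)) + of_nat m powr (1 - s)) \<longlonglongrightarrow> zeta_reg s"
proof -
  obtain d where "d > 0" "uniform_limit (cball s d) (\<lambda>m s. s + (\<Sum>n<m. zeta_incr (Suc n) s)) zeta_reg sequentially"
    using zeta_reg_uniform_limit[OF assms] by blast
  then have "(\<lambda>m. s + (\<Sum>n<m. zeta_incr (Suc n) s)) \<longlonglongrightarrow> zeta_reg s"
    by (intro tendsto_uniform_limitI) auto
  then show ?thesis unfolding sum_zeta_incr by (rule LIMSEQ_imp_Suc)
qed

text \<open>\<open>zeta\<close> is defined by \<open>lim\<close>, which is informative only once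
  convergence is known; dividing the convergent sequence for \<open>zeta_reg\<close> by s - 1
  supplies it.\<close>

lemma zeta_eq_zeta_reg:
  assumes "Re s > 0" "s \<noteq> 1"
  shows "zeta s = zeta_reg s / (s - 1)"
proof -
  have "(\<lambda>m. ((s - 1) * (\<Sum>k<m. of_nat (Suc k) powr (-s)) + of_nat m powr (1 - s)) / (s - 1)) \<longlonglongrightarrow> zeta_reg s / (s - 1)"
    using assms by (intro tendsto_divide zeta_reg_lim) auto
  moreover have "((s - 1) * (\<Sum>k<m. of_nat (Suc k) powr (-s)) + of_nat m powr (1 - s)) / (s - 1) =
      (\<Sum>k=1..m. of_nat k powr (-s)) - of_nat m powr (1 - s) / (1 - s)" for m
  proof -
    have "(\<Sum>k<m. of_nat (Suc k) powr (-s)) = (\<Sum>k=1..m. of_nat k powr (-s))"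
      by (rule sum.reindex_bij_witness[of _ "\<lambda>k. k - 1" Suc]) (auto simp del: of_nat_Suc)
    then show ?thesis using assms by (simp add: field_simps)
  qed
  ultimately show ?thesis unfolding zeta_def by (simp add: limI)
qed

lemma zeta_reg_1 [simp]: "zeta_reg 1 = 1"
proof -
  have "(\<lambda>m. (1 - 1) * (\<Sum>k<m. of_nat (Suc k) powr (-1)) + of_nat m powr (1 - 1)) \<longlonglongrightarrow> zeta_reg 1"
    by (rule zeta_reg_lim) simp
  \<comment> \<open>The shift skips m = 0, where \<open>0 powr 0\<close> is 0 and not 1.\<close>
  then have "(\<lambda>m. of_nat (Suc m) powr 0) \<longlonglongrightarrow> zeta_reg 1"
    by (intro LIMSEQ_Suc) simp
  then have "(\<lambda>m::nat. 1) \<longlonglongrightarrow> zeta_reg 1"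
    by (simp add: powr_def del: of_nat_Suc)
  then show ?thesis by (simp add: LIMSEQ_const_iff)
qed

section \<open>Dirichlet series in the half plane Re s > 1\<close>

text \<open>Here the correction term m^(1-s) tends to 0, so the limit defining
  \<open>zeta_reg\<close> is that of the plain series times s - 1.\<close>

lemma zeta_sums:
  assumes "Re s > 1"
  shows "(\<lambda>k. of_nat (Suc k) powr (-s)) sums (zeta_reg s / (s - 1))"
proof -
  have "s \<noteq> 1" using assms by auto
  have "(\<lambda>m. (of_nat m :: complex) powr (1 - s)) \<longlonglongrightarrow> 0"
  proof (rule tendsto_norm_zero_cancel, rule Lim_transform_eventually)
    show "(\<lambda>m. real m powr (1 - Re s)) \<longlonglongrightarrow> 0"
      using assms by (intro tendsto_neg_powr filterlim_real_sequentially) auto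
    show "\<forall>\<^sub>F m in sequentially. real m powr (1 - Re s) = norm ((of_nat m :: complex) powr (1 - s))"
      using eventually_gt_at_top[of 0] by eventually_elim (simp add: norm_of_nat_powr)
  qed
  then have "(\<lambda>m. ((s - 1) * (\<Sum>k<m. of_nat (Suc k) powr (-s)) + of_nat m powr (1 - s) - of_nat m powr (1 - s)) / (s - 1))
      \<longlonglongrightarrow> (zeta_reg s - 0) / (s - 1)"
    using assms \<open>s \<noteq> 1\<close> by (intro tendsto_intros zeta_reg_lim) auto
  then show ?thesis using \<open>s \<noteq> 1\<close> by (simp add: sums_def)
qed

lemma zeta_abs_summable:
  assumes "Re s > 1"
  shows "summable (\<lambda>k. norm ((of_nat (Suc k) :: complex) powr (-s)))"
proof -
  have "summable (\<lambda>k. real k powr (- Re s))" using assms by (simp add: summable_real_powr_iff)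
  then have "summable (\<lambda>k. real (Suc k) powr (- Re s))" by (subst summable_Suc_iff)
  then show ?thesis by (simp add: norm_of_nat_powr del: of_nat_Suc)
qed

text \<open>Absolute summability allows the double series over pairs (x, y) to be summed in two
  ways: by rows, which gives A B, and along the classes x y = n, which gives the divisor
  sums.\<close>

lemma dirichlet_product_sums:
  fixes f g :: "nat \<Rightarrow> complex"
  assumes f: "summable (\<lambda>k. norm (f (Suc k)))" "(\<lambda>k. f (Suc k)) sums A"
    and g: "summable (\<lambda>k. norm (g (Suc k)))" "(\<lambda>k. g (Suc k)) sums B"
  shows "(\<lambda>k. \<Sum>d | d dvd Suc k. f d * g (Suc k div d)) sums (A * B)"
proof -
  have bij: "bij_betw Suc UNIV {0<..}"
    by (rule bij_betwI[of _ _ _ "\<lambda>k. k - 1"]) auto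
  have hs: "(h has_sum S) {0<..}" if "summable (\<lambda>k. norm (h (Suc k)))" "(\<lambda>k. h (Suc k)) sums S" for h :: "nat \<Rightarrow> complex" and S
    using norm_summable_imp_has_sum[OF that] has_sum_reindex_bij_betw[OF bij, of h S] by simp
  have abs: "(\<lambda>x. norm (h x)) summable_on {0<..}" if "summable (\<lambda>k. norm (h (Suc k)))" for h :: "nat \<Rightarrow> complex"
    using that summable_on_reindex_bij_betw[OF bij, of "\<lambda>k. norm (h k)"]
    by (simp add: summable_on_UNIV_nonneg_real_iff)
  have "(\<lambda>z. norm (case z of (x, y) \<Rightarrow> f x * g y)) summable_on {0<..} \<times> {0<..}"
  proof (rule summable_on_SigmaI)
    fix x :: nat
    show "((\<lambda>y. norm (case (x, y) of (x, y) \<Rightarrow> f x * g y)) has_sum norm (f x) * (\<Sum>\<^sub>\<infinity>y\<in>{0<..}. norm (g y))) {0<..}"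
      using has_sum_cmult_right[OF has_sum_infsum[OF abs[OF g(1)]], of "norm (f x)"] by (simp add: norm_mult)
  next
    show "(\<lambda>x. norm (f x) * (\<Sum>\<^sub>\<infinity>y\<in>{0<..}. norm (g y))) summable_on {0<..}"
      by (rule summable_on_cmult_left[OF abs[OF f(1)]])
  qed simp
  then have sm: "(\<lambda>(x, y). f x * g y) summable_on {0<..} \<times> {0<..}"
    by (rule abs_summable_summable)
  then obtain T where T: "((\<lambda>(x, y). f x * g y) has_sum T) ({0<..} \<times> {0<..})"
    by (auto simp: summable_on_def)
  have "((\<lambda>x. f x * B) has_sum T) {0<..}"
  proof (rule has_sum_SigmaD[OF T])
    fix x show "((\<lambda>y. case (x, y) of (x, y) \<Rightarrow> f x * g y) has_sum f x * B) {0<..}"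
      using has_sum_cmult_right[OF hs[OF g], of "f x"] by simp
  qed
  then have "T = A * B"
    using has_sum_cmult_left[OF hs[OF f], of B] has_sum_unique by blast
  have bij': "bij_betw (\<lambda>(n::nat, d). (d, n div d)) (SIGMA n:{0<..}. {d. d dvd n}) ({0<..} \<times> {0<..})"
    by (rule bij_betwI[of _ _ _ "\<lambda>(x, y). (x * y, x)"]) (auto intro: Nat.gr0I elim!: dvdE)
  have "((\<lambda>z. case (case z of (n, d) \<Rightarrow> (d, n div d)) of (x, y) \<Rightarrow> f x * g y) has_sum T) (SIGMA n:{0<..}. {d. d dvd n})"
    using T by (subst has_sum_reindex_bij_betw[OF bij'])
  then have "((\<lambda>n. \<Sum>d | d dvd n. f d * g (n div d)) has_sum T) {0<..}"
    by (rule has_sum_SigmaD) (auto intro!: has_sum_finiteI)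
  then have "((\<lambda>k. \<Sum>d | d dvd Suc k. f d * g (Suc k div d)) has_sum T) UNIV"
    by (subst has_sum_reindex_bij_betw[OF bij])
  then show ?thesis using \<open>T = A * B\<close> by (auto dest: has_sum_imp_sums)
qed

lemma powr_divisor_mult:
  assumes "d dvd Suc k"
  shows "(of_nat d :: complex) powr (-s) * of_nat (Suc k div d) powr (-s) = of_nat (Suc k) powr (-s)"
proof -
  obtain e where e: "Suc k = d * e" using assms by auto
  have "d > 0" "e > 0" using e by (metis mult_0 mult_0_right nat.distinct(1) gr0I)+
  then have "(of_nat (Suc k) :: complex) powr (-s) = of_nat d powr (-s) * of_nat e powr (-s)"
    unfolding e of_nat_mult by (intro powr_times_real) auto
  moreover have "Suc k div d = e" using e \<open>d > 0\<close> by simp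
  ultimately show ?thesis by simp
qed

text \<open>The divisor sums of mu leave only the term n = 1, so the product of the two series is 1;
  the nonvanishing comes from the same identity.\<close>

lemma moebius_mu_zeta:
  assumes "Re s > 1"
  shows "(\<lambda>k. moebius_mu (Suc k) * of_nat (Suc k) powr (-s)) sums ((s - 1) / zeta_reg s)"
    and "zeta_reg s \<noteq> 0"
proof -
  let ?f = "\<lambda>k. moebius_mu k * of_nat k powr (-s)"
  let ?g = "\<lambda>k. (of_nat k :: complex) powr (-s)"
  have sm: "summable (\<lambda>k. norm (?f (Suc k)))"
    by (rule summable_comparison_test'[OF zeta_abs_summable[OF assms], of 0])
      (use norm_moebius_le in \<open>simp add: norm_mult mult_left_le_one_le del: of_nat_Suc\<close>)
  then obtain M where M: "(\<lambda>k. ?f (Suc k)) sums M"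
    using summable_norm_cancel[OF sm] unfolding summable_def by blast
  have "(\<lambda>k. \<Sum>d | d dvd Suc k. ?f d * ?g (Suc k div d)) sums (M * (zeta_reg s / (s - 1)))"
    by (rule dirichlet_product_sums[OF sm M zeta_abs_summable[OF assms] zeta_sums[OF assms]])
  also have "(\<lambda>k. \<Sum>d | d dvd Suc k. ?f d * ?g (Suc k div d)) = (\<lambda>k. if k = 0 then 1 else 0)"
  proof
    fix k
    have "(\<Sum>d | d dvd Suc k. ?f d * ?g (Suc k div d)) = (\<Sum>d | d dvd Suc k. moebius_mu d) * ?g (Suc k)"
      unfolding sum_distrib_right
      by (intro sum.cong refl) (simp add: powr_divisor_mult mult.assoc del: of_nat_Suc)
    then show "(\<Sum>d | d dvd Suc k. ?f d * ?g (Suc k div d)) = (if k = 0 then 1 else 0)"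
      by (simp add: sum_moebius_divisors)
  qed
  finally have "M * (zeta_reg s / (s - 1)) = 1"
    using sums_If_finite_set[of "{0::nat}" "\<lambda>_. 1::complex"] sums_unique2 by fastforce
  moreover have "s \<noteq> 1" using assms by auto
  ultimately have *: "M * zeta_reg s = s - 1" by (simp add: divide_eq_eq)
  then show "zeta_reg s \<noteq> 0" using \<open>s \<noteq> 1\<close> by auto
  then have "M = (s - 1) / zeta_reg s" using * by (simp add: eq_divide_eq)
  then show "(\<lambda>k. ?f (Suc k)) sums ((s - 1) / zeta_reg s)" using M by simp
qed

text \<open>The value is minus the derivative of \<open>zeta_reg s / (s - 1)\<close>, and the terms
  are minus the derivatives of n^(-s). A locally uniform summable majorant justifies differentiating
  term by term.\<close>

lemma zeta_deriv_sums:
  assumes "Re s > 1"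
  shows "(\<lambda>k. of_real (ln (real (Suc k))) * of_nat (Suc k) powr (-s)) sums
     (zeta_reg s / (s - 1)\<^sup>2 - deriv zeta_reg s / (s - 1))"
proof -
  let ?S = "{s. Re s > 1}"
  have S: "open ?S" by (rule open_halfspace_Re_gt)
  have der: "((\<lambda>s::complex. of_nat (Suc n) powr (-s)) has_field_derivative - (of_real (ln (real (Suc n))) * of_nat (Suc n) powr (-x))) (at x)"
    if "x \<in> ?S" for n x
  proof -
    have "((\<lambda>s::complex. of_nat (Suc n) powr (-s)) has_field_derivative (Ln (of_nat (Suc n)) * of_nat (Suc n) powr (-x)) * (-1)) (at x)"
      by (rule DERIV_chain2[OF has_field_derivative_powr_right])
        (auto intro!: derivative_eq_intros simp del: of_nat_Suc)
    then show ?thesis by (simp add: Ln_of_nat del: of_nat_Suc)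
  qed
  have "\<exists>d. \<exists>h :: nat \<Rightarrow> complex. 0 < d \<and> summable h \<and> range h \<subseteq> \<real>\<^sub>\<ge>\<^sub>0 \<and>
      (\<forall>\<^sub>F n in sequentially. \<forall>y\<in>ball x d \<inter> ?S. norm (of_nat (Suc n) powr (-y) :: complex) \<le> norm (h n))" if "x \<in> ?S" for x
  proof -
    \<comment> \<open>Halfway between 1 and Re x: the exponent \<sigma> still exceeds 1, and Re y
      stays at least \<sigma> on the ball of radius Re x - \<sigma>.\<close>
    define \<sigma> where "\<sigma> = (1 + Re x) / 2"
    have \<sigma>: "\<sigma> > 1" using that by (simp add: \<sigma>_def)
    have d: "0 < Re x - \<sigma>" using that by (simp add: \<sigma>_def)
    have h: "summable (\<lambda>n. of_real (real (Suc n) powr (-\<sigma>)) :: complex)"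
      using zeta_abs_summable[of "of_real \<sigma>"] \<sigma>
      by (simp add: summable_complex_of_real norm_of_nat_powr del: of_nat_Suc)
    have r: "range (\<lambda>n. of_real (real (Suc n) powr (-\<sigma>)) :: complex) \<subseteq> \<real>\<^sub>\<ge>\<^sub>0"
      by auto
    have "norm (of_nat (Suc n) powr (-y) :: complex) \<le> norm (of_real (real (Suc n) powr (-\<sigma>)) :: complex)"
      if "y \<in> ball x (Re x - \<sigma>)" for n y
    proof -
      have "Re y \<ge> \<sigma>" using that abs_Re_le_cmod[of "x - y"] by (simp add: dist_norm)
      then show ?thesis by (simp add: norm_of_nat_powr powr_mono del: of_nat_Suc)
    qed
    then have *: "\<forall>\<^sub>F n in sequentially. \<forall>y\<in>ball x (Re x - \<sigma>) \<inter> ?S.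
        norm (of_nat (Suc n) powr (-y) :: complex) \<le> norm (of_real (real (Suc n) powr (-\<sigma>)) :: complex)"
      by auto
    show ?thesis
      by (rule exI[of _ "Re x - \<sigma>"], rule exI[of _ "\<lambda>n. of_real (real (Suc n) powr (-\<sigma>))"]) (intro conjI d h r *)
  qed
  then have "\<exists>g g'. \<forall>x\<in>?S. (\<lambda>n. of_nat (Suc n) powr (-x)) sums g x \<and>
      (\<lambda>n. - (of_real (ln (real (Suc n))) * of_nat (Suc n) powr (-x))) sums g' x \<and> (g has_field_derivative g' x) (at x)"
    by (intro series_and_derivative_comparison_complex[OF S der])
  then obtain g g' where gg: "\<forall>x\<in>?S. (\<lambda>n. of_nat (Suc n) powr (-x)) sums g x \<and>
      (\<lambda>n. - (of_real (ln (real (Suc n))) * of_nat (Suc n) powr (-x))) sums g' x \<and> (g has_field_derivative g' x) (at x)"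
    by blast
  then have g: "(\<lambda>n. of_nat (Suc n) powr (-x)) sums g x"
    "(\<lambda>n. - (of_real (ln (real (Suc n))) * of_nat (Suc n) powr (-x))) sums g' x"
    "(g has_field_derivative g' x) (at x)" if "x \<in> ?S" for x
    using that by blast+
  have "((\<lambda>x. zeta_reg x / (x - 1)) has_field_derivative g' s) (at s)"
  proof (rule has_field_derivative_transform_within_open[OF g(3) S])
    fix x assume "x \<in> ?S"
    then show "g x = zeta_reg x / (x - 1)" using g(1) zeta_sums[of x] sums_unique2 by blast
  qed (use assms in auto)
  moreover have "(zeta_reg has_field_derivative deriv zeta_reg s) (at s)"
    using assms by (intro holomorphic_derivI[OF zeta_reg_holomorphic open_halfspace_Re_gt]) auto
  then have "((\<lambda>x. zeta_reg x / (x - 1)) has_field_derivative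
      (deriv zeta_reg s * (s - 1) - zeta_reg s * 1) / ((s - 1) * (s - 1))) (at s)"
    using assms by (auto intro!: derivative_eq_intros)
  ultimately have "g' s = (deriv zeta_reg s * (s - 1) - zeta_reg s * 1) / ((s - 1) * (s - 1))"
    by (rule DERIV_unique)
  moreover have "s \<noteq> 1" using assms by auto
  ultimately have "- g' s = zeta_reg s / (s - 1)\<^sup>2 - deriv zeta_reg s / (s - 1)"
    by (simp add: diff_divide_distrib power2_eq_square)
  then show ?thesis using sums_minus[OF g(2)[of s]] assms by simp
qed

text \<open>The divisor sums of \<open>mangoldt\<close> are the logarithms, so multiplying by the
  zeta series gives the series of \<open>zeta_deriv_sums\<close>, and one divides. The value is
  -zeta'/zeta with the contribution of the pole, 1 / (s - 1), split off.\<close>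

lemma mangoldt_sums:
  assumes "Re s > 1"
  shows "(\<lambda>k. mangoldt (Suc k) * of_nat (Suc k) powr (-s)) sums (1 / (s - 1) - deriv zeta_reg s / zeta_reg s)"
proof -
  let ?f = "\<lambda>k. (mangoldt k :: complex) * of_nat k powr (-s)"
  let ?g = "\<lambda>k. (of_nat k :: complex) powr (-s)"
  \<comment> \<open>At the real point Re s the series with logarithms has nonnegative terms, so its
    convergence is absolute and dominates the one with \<open>mangoldt\<close>.\<close>
  have "summable (\<lambda>k. Re (of_real (ln (real (Suc k))) * of_nat (Suc k) powr (- of_real (Re s))))"
    by (intro summable_Re sums_summable[OF zeta_deriv_sums]) (use assms in simp)
  moreover have "Re (of_real (ln (real (Suc k))) * of_nat (Suc k) powr (- of_real (Re s))) = ln (real (Suc k)) * real (Suc k) powr (- Re s)" for k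
  proof -
    have "(of_nat (Suc k) :: complex) powr (- of_real (Re s)) = of_real (real (Suc k)) powr of_real (- Re s)"
      by simp
    also have "\<dots> = of_real (real (Suc k) powr (- Re s))"
      by (rule powr_of_real) auto
    finally show ?thesis by (simp del: of_nat_Suc)
  qed
  ultimately have "summable (\<lambda>k. ln (real (Suc k)) * real (Suc k) powr (- Re s))" by (simp only:)
  then have sm: "summable (\<lambda>k. norm (?f (Suc k)))"
  proof (rule summable_comparison_test'[where N = 0])
    fix k
    have "norm (?f (Suc k)) = mangoldt (Suc k) * real (Suc k) powr (- Re s)"
      by (simp add: norm_mult norm_of_nat_powr del: of_nat_Suc)
    also have "\<dots> \<le> ln (real (Suc k)) * real (Suc k) powr (- Re s)"
      by (intro mult_right_mono mangoldt_le) auto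
    finally show "norm (norm (?f (Suc k))) \<le> ln (real (Suc k)) * real (Suc k) powr (- Re s)" by simp
  qed
  then obtain L where L: "(\<lambda>k. ?f (Suc k)) sums L"
    using summable_norm_cancel[OF sm] unfolding summable_def by blast
  have "(\<lambda>k. \<Sum>d | d dvd Suc k. ?f d * ?g (Suc k div d)) sums (L * (zeta_reg s / (s - 1)))"
    by (rule dirichlet_product_sums[OF sm L zeta_abs_summable[OF assms] zeta_sums[OF assms]])
  also have "(\<lambda>k. \<Sum>d | d dvd Suc k. ?f d * ?g (Suc k div d)) = (\<lambda>k. of_real (ln (real (Suc k))) * ?g (Suc k))"
  proof
    fix k
    have "(\<Sum>d | d dvd Suc k. ?f d * ?g (Suc k div d)) = (\<Sum>d | d dvd Suc k. mangoldt d) * ?g (Suc k)"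
      unfolding sum_distrib_right
      by (intro sum.cong refl) (simp add: powr_divisor_mult mult.assoc del: of_nat_Suc)
    then show "(\<Sum>d | d dvd Suc k. ?f d * ?g (Suc k div d)) = of_real (ln (real (Suc k))) * ?g (Suc k)"
      by (subst (asm) mangoldt_sum) auto
  qed
  finally have "L * (zeta_reg s / (s - 1)) = zeta_reg s / (s - 1)\<^sup>2 - deriv zeta_reg s / (s - 1)"
    using zeta_deriv_sums[OF assms] sums_unique2 by blast
  also have "\<dots> = (1 / (s - 1) - deriv zeta_reg s / zeta_reg s) * (zeta_reg s / (s - 1))"
  proof -
    have "E / u\<^sup>2 - D / u = (1 / u - D / E) * (E / u)" if "E \<noteq> 0" for D E u :: complex
      using that by (simp add: left_diff_distrib diff_divide_distrib power2_eq_square)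
    then show ?thesis using moebius_mu_zeta(2)[OF assms] by simp
  qed
  finally have "L = 1 / (s - 1) - deriv zeta_reg s / zeta_reg s"
    using moebius_mu_zeta(2)[OF assms] assms by (subst (asm) mult_right_cancel) auto
  then show ?thesis using L by simp
qed

section \<open>Nonvanishing on the line Re s = 1\<close>

text \<open>m is the order of the zero at z. Writing \<open>zeta_reg\<close> as g(w) (w - z)^m with
  g nonzero near z, the logarithmic derivative is m / (w - z) + g'/g, and at w = z + x
  multiplication by x leaves m in the limit.\<close>

lemma zeta_reg_log_deriv_residue:
  assumes "Re z > 0"
  obtains m :: nat where "m = 0 \<longleftrightarrow> zeta_reg z \<noteq> 0"
    "((\<lambda>x. of_real x * (deriv zeta_reg (z + of_real x) / zeta_reg (z + of_real x))) \<longlongrightarrow> of_nat m) (at_right 0)"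
proof -
  let ?S = "{s. Re s > 0}"
  have S: "open ?S" "connected ?S"
    by (auto intro: open_halfspace_Re_gt convex_connected convex_halfspace_Re_gt)
  have "\<exists>w\<in>?S. zeta_reg w \<noteq> 0" by (rule bexI[of _ 1]) auto
  moreover have "z \<in> ?S" using assms by simp
  ultimately have Z: "(if zeta_reg z = 0 then zorder zeta_reg z > 0 else zorder zeta_reg z = 0) \<and>
    (\<exists>r>0. cball z r \<subseteq> ?S \<and> zor_poly zeta_reg z holomorphic_on cball z r \<and>
      (\<forall>w\<in>cball z r. zeta_reg w = zor_poly zeta_reg z w * (w - z) ^ nat (zorder zeta_reg z) \<and> zor_poly zeta_reg z w \<noteq> 0))"
    by (intro zorder_exist_zero[OF zeta_reg_holomorphic S])
  note r1 = conjunct1[OF Z]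
  from conjunct2[OF Z] obtain r where r: "r > 0" "zor_poly zeta_reg z holomorphic_on cball z r"
    "\<And>w. w \<in> cball z r \<Longrightarrow> zeta_reg w = zor_poly zeta_reg z w * (w - z) ^ nat (zorder zeta_reg z)"
    "\<And>w. w \<in> cball z r \<Longrightarrow> zor_poly zeta_reg z w \<noteq> 0"
    by (elim exE conjE) blast
  define m where "m = nat (zorder zeta_reg z)"
  define g where "g = zor_poly zeta_reg z"
  have g: "g holomorphic_on ball z r" using r(2) unfolding g_def by (rule holomorphic_on_subset) auto
  have g': "(g has_field_derivative deriv g w) (at w)" if "w \<in> ball z r" for w
    using holomorphic_derivI[OF g open_ball that] .
  have lim: "((\<lambda>x. of_nat m + of_real x * (deriv g (z + of_real x) / g (z + of_real x))) \<longlongrightarrow>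
      of_nat m + of_real 0 * (deriv g (z + of_real 0) / g (z + of_real 0))) (at_right 0)"
  proof (intro tendsto_intros)
    have cont: "isCont g z" "isCont (deriv g) z"
      using r(1) g holomorphic_deriv[OF g open_ball]
      by (auto intro!: continuous_on_interior[of "ball z r"] holomorphic_on_imp_continuous_on)
    have lim: "((\<lambda>x. z + complex_of_real x) \<longlongrightarrow> z) (at_right 0)"
      by (auto intro!: tendsto_eq_intros)
    show "((\<lambda>x. g (z + complex_of_real x)) \<longlongrightarrow> g (z + of_real 0)) (at_right 0)"
      "((\<lambda>x. deriv g (z + complex_of_real x)) \<longlongrightarrow> deriv g (z + of_real 0)) (at_right 0)"
      using isCont_tendsto_compose[OF cont(1) lim] isCont_tendsto_compose[OF cont(2) lim] by simp_all
    show "g (z + of_real 0) \<noteq> 0" using r(1,4) by (simp add: g_def)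
  qed
  have "\<forall>\<^sub>F x in at_right 0. of_nat m + of_real x * (deriv g (z + of_real x) / g (z + of_real x)) =
      of_real x * (deriv zeta_reg (z + of_real x) / zeta_reg (z + of_real x))"
    using eventually_at_right_real[OF r(1)]
  proof eventually_elim
    case (elim x)
    define w where "w = z + of_real x"
    have w: "w \<in> ball z r" "w - z = of_real x" "x > 0" using elim by (auto simp: w_def dist_norm)
    have g0: "g w \<noteq> 0" using r(4) w by (simp add: g_def)
    \<comment> \<open>For m = 0 the truncated exponent \<open>m - 1\<close> does no harm, as its
      power is multiplied by \<open>of_nat m\<close>.\<close>
    have "((\<lambda>w. g w * (w - z) ^ m) has_field_derivative
        deriv g w * (w - z) ^ m + g w * (of_nat m * (w - z) ^ (m - 1))) (at w)"
      using g'[OF w(1)] by (auto intro!: derivative_eq_intros)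
    then have "(zeta_reg has_field_derivative deriv g w * (w - z) ^ m + g w * (of_nat m * (w - z) ^ (m - 1))) (at w)"
      by (rule has_field_derivative_transform_within_open[OF _ open_ball w(1)]) (simp add: r(3) g_def m_def)
    then have "deriv zeta_reg w = deriv g w * (w - z) ^ m + g w * (of_nat m * (w - z) ^ (m - 1))"
      by (rule DERIV_imp_deriv)
    moreover have "zeta_reg w = g w * (w - z) ^ m" using r(3) w(1) by (simp add: g_def m_def)
    moreover have "of_real x * ((D * of_real x ^ m + G * (of_nat m * of_real x ^ (m - 1))) / (G * of_real x ^ m)) =
        of_nat m + of_real x * (D / G)" if "G \<noteq> 0" for D G :: complex
    proof (cases m)
      case (Suc j)
      have "X * ((D * (X * P) + G * (M * P)) / (G * (X * P))) = M + X * (D / G)"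
        if "X \<noteq> 0" "P \<noteq> 0" for X P M :: complex
        using that \<open>G \<noteq> 0\<close> by (simp add: add_divide_distrib distrib_left)
      from this[of "of_real x" "of_real x ^ j" "of_nat m"] show ?thesis using w(3) by (simp add: Suc)
    qed (use that in simp)
    ultimately have "of_nat m + of_real x * (deriv g w / g w) = of_real x * (deriv zeta_reg w / zeta_reg w)"
      using g0 by (simp only: w(2) not_False_eq_True)
    then show ?case unfolding w_def .
  qed
  from Lim_transform_eventually[OF lim this]
  have res: "((\<lambda>x. of_real x * (deriv zeta_reg (z + of_real x) / zeta_reg (z + of_real x))) \<longlongrightarrow> of_nat m) (at_right 0)"
    by (simp only: of_real_0 mult_zero_left add_0_right)
  have "m = 0 \<longleftrightarrow> zeta_reg z \<noteq> 0" using r1 by (auto simp: m_def split: if_splits)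
  then show ?thesis using res by (rule that)
qed

lemma three_four_one:
  fixes \<theta> :: real
  shows "3 + 4 * cos \<theta> + cos (2 * \<theta>) \<ge> 0"
proof -
  have "3 + 4 * cos \<theta> + cos (2 * \<theta>) = 2 * (1 + cos \<theta>)\<^sup>2"
    unfolding cos_double_cos by (simp add: power2_eq_square algebra_simps)
  then show ?thesis by simp
qed

text \<open>Let m0, m1, m2 be the orders of vanishing at 1, 1 + it and 1 + 2it. Multiplying the
  positive combination of Mangoldt series by x and letting x tend to 0 gives 0 <= 3 (1 - m0) - 4 m1
  - m2. Since 4 exceeds 3, this forces m1 = 0.\<close>

lemma zeta_reg_nonzero:
  assumes "Re s = 1"
  shows "zeta_reg s \<noteq> 0"
proof (cases "s = 1")
  case False
  define t where "t = Im s"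
  have s: "s = 1 + \<i> * of_real t" using assms by (simp add: t_def complex_eq_iff)
  have t: "t \<noteq> 0" using False s by auto
  define L where "L = (\<lambda>s. 1 / (s - 1) - deriv zeta_reg s / zeta_reg s)"
  \<comment> \<open>The limit is minus the order of the zero, with 1 added at u = 0: there the term
    1 / (s - 1) of \<open>L\<close> becomes 1 / x.\<close>
  define P where "P = (\<lambda>(u::real) (m::nat). (m = 0 \<longleftrightarrow> zeta_reg (1 + \<i> * of_real u) \<noteq> 0) \<and>
      ((\<lambda>x. of_real x * L (1 + \<i> * of_real u + of_real x)) \<longlongrightarrow> (if u = 0 then 1 else 0) - of_nat m) (at_right 0))"
  have lim: "\<exists>m. P u m" for u
  proof -
    obtain m :: nat where m: "m = 0 \<longleftrightarrow> zeta_reg (1 + \<i> * of_real u) \<noteq> 0"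
      "((\<lambda>x. of_real x * (deriv zeta_reg (1 + \<i> * of_real u + of_real x) / zeta_reg (1 + \<i> * of_real u + of_real x))) \<longlongrightarrow> of_nat m) (at_right 0)"
      by (rule zeta_reg_log_deriv_residue[of "1 + \<i> * of_real u"]) auto
    have "((\<lambda>x. of_real x / (\<i> * of_real u + of_real x) :: complex) \<longlongrightarrow> (if u = 0 then 1 else 0)) (at_right 0)"
    proof (cases "u = 0")
      case True
      have "\<forall>\<^sub>F x::real in at_right 0. 1 = (of_real x / (\<i> * of_real u + of_real x) :: complex)"
        using eventually_at_right_less[of 0] by eventually_elim (simp add: True)
      then show ?thesis using True by (auto intro: Lim_transform_eventually[OF tendsto_const])
    next
      case False
      have "((\<lambda>x. of_real x / (\<i> * of_real u + of_real x) :: complex) \<longlongrightarrow> of_real 0 / (\<i> * of_real u + of_real 0)) (at_right 0)"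
        using False by (intro tendsto_intros) auto
      then show ?thesis using False by simp
    qed
    from tendsto_diff[OF this m(2)] m(1) show ?thesis
      by (intro exI[of _ m]) (simp add: P_def L_def right_diff_distrib)
  qed
  obtain m0 m1 m2 where m: "P 0 m0" "P t m1" "P (2 * t) m2" using lim by blast
  have m0: "((\<lambda>x. of_real x * L (1 + of_real x)) \<longlongrightarrow> 1 - of_nat m0) (at_right 0)"
    using conjunct2[OF m(1)[unfolded P_def]] by simp
  have m1: "m1 = 0 \<longleftrightarrow> zeta_reg s \<noteq> 0"
     "((\<lambda>x. of_real x * L (1 + \<i> * of_real t + of_real x)) \<longlongrightarrow> - of_nat m1) (at_right 0)"
    using conjunct1[OF m(2)[unfolded P_def]] conjunct2[OF m(2)[unfolded P_def]] t s by simp_all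
  have m2: "((\<lambda>x. of_real x * L (1 + \<i> * of_real (2 * t) + of_real x)) \<longlongrightarrow> - of_nat m2) (at_right 0)"
    using conjunct2[OF m(3)[unfolded P_def]] t by simp
  have "((\<lambda>x. Re (3 * (of_real x * L (1 + of_real x)) + 4 * (of_real x * L (1 + \<i> * of_real t + of_real x))
      + of_real x * L (1 + \<i> * of_real (2 * t) + of_real x))) \<longlongrightarrow>
      Re (3 * (1 - of_nat m0) + 4 * (- of_nat m1) + (- of_nat m2))) (at_right 0)"
    by (intro tendsto_intros m0 m1 m2)
  moreover have "\<forall>\<^sub>F x in at_right 0. 0 \<le> Re (3 * (of_real x * L (1 + of_real x)) + 4 * (of_real x * L (1 + \<i> * of_real t + of_real x))
      + of_real x * L (1 + \<i> * of_real (2 * t) + of_real x))"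
    using eventually_at_right_less[of 0]
  proof eventually_elim
    case (elim x)
    have sums: "(\<lambda>k. mangoldt (Suc k) * (real (Suc k) powr (-1 - x) * cos (u * ln (real (Suc k))))) sums
        Re (L (1 + \<i> * of_real u + of_real x))" for u
    proof -
      have "(\<lambda>k. Re (mangoldt (Suc k) * of_nat (Suc k) powr (-(1 + \<i> * of_real u + of_real x)))) sums Re (L (1 + \<i> * of_real u + of_real x))"
        unfolding L_def using elim by (intro sums_Re mangoldt_sums) simp
      moreover have "Re (mangoldt (Suc k) * of_nat (Suc k) powr (-(1 + \<i> * of_real u + of_real x))) =
          mangoldt (Suc k) * (real (Suc k) powr (-1 - x) * cos (u * ln (real (Suc k))))" for k
        by (simp add: powr_def Ln_of_nat Re_exp cos_minus algebra_simps del: of_nat_Suc)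
      ultimately show ?thesis by (simp only:)
    qed
    have "(\<lambda>k. 3 * (mangoldt (Suc k) * (real (Suc k) powr (-1 - x) * cos (0 * ln (real (Suc k)))))
        + 4 * (mangoldt (Suc k) * (real (Suc k) powr (-1 - x) * cos (t * ln (real (Suc k)))))
        + mangoldt (Suc k) * (real (Suc k) powr (-1 - x) * cos ((2 * t) * ln (real (Suc k))))) sums
        (3 * Re (L (1 + \<i> * of_real 0 + of_real x)) + 4 * Re (L (1 + \<i> * of_real t + of_real x)) + Re (L (1 + \<i> * of_real (2 * t) + of_real x)))"
      by (intro sums_add sums_mult sums)
    moreover have "0 \<le> 3 * (mangoldt (Suc k) * (real (Suc k) powr (-1 - x) * cos (0 * ln (real (Suc k)))))
        + 4 * (mangoldt (Suc k) * (real (Suc k) powr (-1 - x) * cos (t * ln (real (Suc k)))))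
        + mangoldt (Suc k) * (real (Suc k) powr (-1 - x) * cos ((2 * t) * ln (real (Suc k))))" (is "0 \<le> ?a") for k
    proof -
      have "?a = mangoldt (Suc k) * real (Suc k) powr (-1 - x) * (3 + 4 * cos (t * ln (real (Suc k))) + cos (2 * (t * ln (real (Suc k)))))"
        by (simp add: algebra_simps)
      also have "\<dots> \<ge> 0" by (intro mult_nonneg_nonneg three_four_one mangoldt_nonneg) auto
      finally show ?thesis .
    qed
    ultimately have "0 \<le> 3 * Re (L (1 + \<i> * of_real 0 + of_real x)) + 4 * Re (L (1 + \<i> * of_real t + of_real x)) + Re (L (1 + \<i> * of_real (2 * t) + of_real x))"
      by (metis (no_types, lifting) sums_le sums_zero)
    then have "0 \<le> x * (3 * Re (L (1 + of_real x)) + 4 * Re (L (1 + \<i> * of_real t + of_real x)) + Re (L (1 + \<i> * of_real (2 * t) + of_real x)))"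
      using elim by simp
    then show ?case by (simp add: algebra_simps)
  qed
  ultimately have "0 \<le> Re (3 * (1 - of_nat m0) + 4 * (- of_nat m1) + (- of_nat m2))"
    by (intro tendsto_lowerbound) auto
  then have "m1 = 0" by simp
  then show ?thesis using m1(1) by simp
qed simp

section \<open>Convergence on Re s = 1 and assembly of the series\<close>

lemma moebius_mu_sums:
  assumes w: "Re w = 1"
  shows "(\<lambda>k. moebius_mu (Suc k) * of_nat (Suc k) powr (-w)) sums ((w - 1) / zeta_reg w)"
proof -
  define b where "b = (\<lambda>k. moebius_mu k * of_nat k powr (-w))"
  define F where "F = (\<lambda>z. (z + w - 1) / zeta_reg (z + w))"
  \<comment> \<open>\<open>zeta_reg (z + w)\<close> is holomorphic for Re z > -1, and deleting its
    zeros leaves an open set. That suffices: nonvanishing for Re z \<ge> 0 puts the closed half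
    plane inside \<open>U\<close>, and no explicit zero-free region enters.\<close>
  define U where "U = {z. Re z > -1} \<inter> (\<lambda>z. zeta_reg (z + w)) -` (- {0})"
  have hol: "(\<lambda>z. zeta_reg (z + w)) holomorphic_on {z. Re z > -1}"
  proof -
    have "(\<lambda>z. z + w) holomorphic_on {z. Re z > -1}" by (intro holomorphic_intros)
    moreover have "(\<lambda>z. z + w) ` {z. Re z > -1} \<subseteq> {s. Re s > 0}" using w by auto
    ultimately show ?thesis
      using holomorphic_on_compose_gen[OF _ zeta_reg_holomorphic] by (auto simp: o_def)
  qed
  have "(\<lambda>k. b (Suc k)) sums F 0"
  proof (rule newman)
    fix k :: nat assume "k \<ge> 1"
    then have "norm ((of_nat k :: complex) powr (-w)) = 1 / real k"
      using w by (subst norm_of_nat_powr) (auto simp: powr_minus divide_inverse)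
    then show "norm (b k) \<le> 1 / real k"
      using mult_right_mono[OF norm_moebius_le[of k], of "1 / real k"] unfolding b_def norm_mult by simp
  next
    show "open U" unfolding U_def
      by (intro continuous_open_preimage holomorphic_on_imp_continuous_on[OF hol] open_halfspace_Re_gt) auto
    show "{z. 0 \<le> Re z} \<subseteq> U"
    proof
      fix z assume z: "z \<in> {z. 0 \<le> Re z}"
      then have "zeta_reg (z + w) \<noteq> 0"
        using w zeta_reg_nonzero[of "z + w"] moebius_mu_zeta(2)[of "z + w"] by (cases "Re z = 0") auto
      then show "z \<in> U" using z by (simp add: U_def)
    qed
    show "F holomorphic_on U" unfolding F_def
      by (intro holomorphic_intros holomorphic_on_subset[OF hol]) (auto simp: U_def)
    fix z assume "Re z > 0"
    then have "(\<lambda>k. moebius_mu (Suc k) * of_nat (Suc k) powr (-(z + w))) sums F z"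
      unfolding F_def using w by (intro moebius_mu_zeta) auto
    moreover have "moebius_mu (Suc k) * of_nat (Suc k) powr (-(z + w)) = b (Suc k) * of_nat (Suc k) powr (-z)" for k
      by (simp add: b_def powr_add[symmetric] algebra_simps del: of_nat_Suc)
    ultimately show "(\<lambda>k. b (Suc k) * of_nat (Suc k) powr (-z)) sums F z" by simp
  qed
  then show ?thesis by (simp add: b_def F_def)
qed

text \<open>Spreading the terms over the multiples of d and filling the gaps with zeros changes
  neither order nor limit, so it is legitimate for conditionally convergent series.\<close>

lemma sums_multiples:
  fixes f :: "nat \<Rightarrow> complex"
  assumes "d > 0" "(\<lambda>k. f (Suc k)) sums S"
  shows "(\<lambda>k. if d dvd Suc k then f (Suc k div d) else 0) sums S"
proof -
  have sub: "(\<lambda>k. (\<lambda>q. if d dvd Suc q then f (Suc q div d) else 0) (d * Suc k - 1)) sums S"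
    using assms by simp
  \<comment> \<open>Index q stands for the number q + 1, so the multiple d (k + 1) sits at index
    \<open>d * Suc k - 1\<close>.\<close>
  have mono: "strict_mono (\<lambda>k. d * Suc k - 1)"
  proof (rule strict_monoI)
    fix x y :: nat assume "x < y"
    then have "d * Suc x < d * Suc y" "0 < d * Suc x" using assms by simp_all
    then show "d * Suc x - 1 < d * Suc y - 1" by linarith
  qed
  have zero: "(if d dvd Suc q then f (Suc q div d) else 0) = 0" if "q \<notin> range (\<lambda>k. d * Suc k - 1)" for q
  proof -
    have False if dvd: "d dvd Suc q"
    proof -
      obtain e where e: "Suc q = d * e" using dvd by auto
      then obtain k where "e = Suc k" by (cases e) auto
      then have "q = d * Suc k - 1" using e by simp
      then show False using \<open>q \<notin> _\<close> by blast
    qed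
    then show ?thesis by auto
  qed
  show ?thesis by (rule iffD1[OF sums_mono_reindex[OF mono zero] sub])
qed

theorem theorem2:
  fixes \<beta> n :: nat and s :: complex
  assumes "\<beta> \<ge> 1" and "n \<ge> 1" and "Re s = 1"
  shows "(\<lambda>q. ramanujan_sum_gen \<beta> (Suc q) n / (of_nat (Suc q) :: complex) powr s) sums
           (if s = 1 then 0 else sigma_gen \<beta> (1 - s / of_nat \<beta>) n / zeta s)"
proof -
  define D where "D = {d::nat. d > 0 \<and> d ^ \<beta> dvd n}"
  have "D \<subseteq> {..n}"
  proof
    fix d assume d: "d \<in> D"
    have "d ^ 1 \<le> d ^ \<beta>" using d assms by (intro power_increasing) (auto simp: D_def)
    also have "\<dots> \<le> n" using d assms by (intro dvd_imp_le) (auto simp: D_def)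
    finally show "d \<in> {..n}" by simp
  qed
  then have fin: "finite D" using finite_subset by blast
  let ?c = "\<lambda>d. of_nat (d ^ \<beta>) * of_nat d powr (-s) :: complex"
  let ?f = "\<lambda>k. moebius_mu k * of_nat k powr (-s)"
  \<comment> \<open>With q + 1 = d m the power (q + 1)^(-s) splits as d^(-s) m^(-s); the factor
    d^(-s) goes into the constant, and every d contributes the same Moebius series.\<close>
  have "(\<lambda>q. \<Sum>d\<in>D. ?c d * (if d dvd Suc q then ?f (Suc q div d) else 0)) sums (\<Sum>d\<in>D. ?c d * ((s - 1) / zeta_reg s))"
    by (intro sums_sum sums_mult sums_multiples moebius_mu_sums assms) (auto simp: D_def)
  also have "(\<lambda>q. \<Sum>d\<in>D. ?c d * (if d dvd Suc q then ?f (Suc q div d) else 0)) =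
      (\<lambda>q. ramanujan_sum_gen \<beta> (Suc q) n / (of_nat (Suc q) :: complex) powr s)"
  proof
    fix q
    have "(\<Sum>d\<in>D. ?c d * (if d dvd Suc q then ?f (Suc q div d) else 0)) =
        (\<Sum>d\<in>D. if d dvd Suc q then of_nat (d ^ \<beta>) * moebius_mu (Suc q div d) * of_nat (Suc q) powr (-s) else 0)"
    proof (intro sum.cong refl)
      fix d
      have "?c d * ?f (Suc q div d) = of_nat (d ^ \<beta>) * moebius_mu (Suc q div d) *
          (of_nat d powr (-s) * of_nat (Suc q div d) powr (-s))"
        by (simp only: mult_ac)
      then show "?c d * (if d dvd Suc q then ?f (Suc q div d) else 0) =
          (if d dvd Suc q then of_nat (d ^ \<beta>) * moebius_mu (Suc q div d) * of_nat (Suc q) powr (-s) else 0)"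
        using powr_divisor_mult[of d q s] by (simp del: of_nat_Suc of_nat_power)
    qed
    also have "\<dots> = (\<Sum>d\<in>{d\<in>D. d dvd Suc q}. of_nat (d ^ \<beta>) * moebius_mu (Suc q div d) * of_nat (Suc q) powr (-s))"
      by (rule sum.inter_filter[symmetric, OF fin])
    also have "{d\<in>D. d dvd Suc q} = {d. d dvd Suc q \<and> d ^ \<beta> dvd n}"
      by (auto simp: D_def intro: Nat.gr0I)
    finally show "(\<Sum>d\<in>D. ?c d * (if d dvd Suc q then ?f (Suc q div d) else 0)) =
        ramanujan_sum_gen \<beta> (Suc q) n / (of_nat (Suc q) :: complex) powr s"
      using assms by (simp add: ramanujan_sum_gen_eq sum_divide_distrib powr_minus_divide del: of_nat_Suc)
  qed
  also have "(\<Sum>d\<in>D. ?c d * ((s - 1) / zeta_reg s)) = (if s = 1 then 0 else sigma_gen \<beta> (1 - s / of_nat \<beta>) n / zeta s)"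
  proof (cases "s = 1")
    case False
    have "sigma_gen \<beta> (1 - s / of_nat \<beta>) n = (\<Sum>d\<in>D. ?c d)"
      unfolding sigma_gen_def D_def[symmetric]
    proof (intro sum.cong refl)
      fix d assume "d \<in> D"
      then have d: "d > 0" by (simp add: D_def)
      \<comment> \<open>The identity behind sigma is (d^\<beta>)^(1 - s/\<beta>) = d^\<beta> d^(-s).
        It is checked through real logarithms of positive numbers, so no choice of branch
        interferes.\<close>
      have "(of_nat (d ^ \<beta>) :: complex) powr (1 - s / of_nat \<beta>) = exp ((1 - s / of_nat \<beta>) * of_real (ln (real d ^ \<beta>)))"
        using d by (simp add: powr_def Ln_of_nat flip: of_nat_power)
      also have "(1 - s / of_nat \<beta>) * of_real (ln (real d ^ \<beta>)) = of_real (ln (real d ^ \<beta>)) + - s * of_real (ln (real d))"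
        using d assms by (simp add: ln_realpow field_simps)
      also have "exp \<dots> = exp (of_real (ln (real d ^ \<beta>))) * exp (- s * of_real (ln (real d)))"
        by (rule exp_add)
      also have "exp (complex_of_real (ln (real d ^ \<beta>))) = of_nat (d ^ \<beta>)"
        using d by (simp add: exp_of_real)
      also have "exp (- s * of_real (ln (real d))) = of_nat d powr (-s)"
        using d by (simp add: powr_def Ln_of_nat)
      finally show "(of_nat (d ^ \<beta>) :: complex) powr (1 - s / of_nat \<beta>) = ?c d" .
    qed
    then show ?thesis
      using False assms zeta_eq_zeta_reg[of s] by (simp add: sum_distrib_right[symmetric] sum_divide_distrib[symmetric])
  qed simp
  finally show ?thesis .
qed

end
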